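(* Let $\mathcal{W}$ be a standard sequence of generating words with bounded spacers such that the minimal Ferenczi subshift $(X_{\mathcal{W}}, S)$ is aperiodic. Then its topological rank is $$\operatorname{rank}(X_{\mathcal{W}}, S) = d_{\mathcal{W}}.$$
   Context: $S$ is the shift; a subshift is aperiodic if it is nonempty and contains no shift-periodic point. Ferenczi subshifts. Given nonnegative integers $(q_n)_{n \ge 0}$ (cutting parameters) and $(a_{n,i} : n \ge 0, 0 \le i < q_n)$ (spacer parameters), the sequence of generating words $\mathcal{W} = (w_n)_{n \ge 0}$ over $\{0,1\}$ is $w_0 = 0$, $w_{n+1} = w_n 1^{a_{n,0}} w_n 1^{a_{n,1}} \cdots w_n 1^{a_{n,q_n-1}} w_n$. $X_{\mathcal{W}}$ is the set of $x \in \{0,1\}^{\mathbb{Z}}$ every finite factor of which is a factor of some $w_n$. $\mathcal{W}$ is standard if $q_n \ge 2$ for all $n$. If the spacers are bounded, $(X_{\mathcal{W}},S)$ is minimal (a minimal Ferenczi subshift). For $n \ge 1$ let $\mathcal{A}_n = \{a_{N,i} : N \ge n-1, 0 \le i < q_N\}$. These finite sets are decreasing; $\mathcal{A}_{\mathcal{W}}$ is their eventual constant value and $d_{\mathcal{W}} = |\mathcal{A}_{\mathcal{W}}|$. Topological rank. A clopen Kakutani–Rokhlin (CKR) partition of a minimal Cantor system $(X,T)$ is a partition $\mathcal{T} = \{T^k B(a) : a \in \mathcal{A}(\mathcal{T}), 0 \le k < h(a)\}$ of $X$, with $\mathcal{A}(\mathcal{T})$ a nonempty finite set, $h(a)$ positive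 integers and $B(a)$ clopen sets; its base is $B(\mathcal{T}) = \bigcup_a B(a)$. A sequence $(\mathcal{T}_n)_{n\ge0}$ of CKR partitions is nested if for all $n$: $B(\mathcal{T}_{n+1}) \subseteq B(\mathcal{T}_n)$; every atom of $\mathcal{T}_{n+1}$ is contained in an atom of $\mathcal{T}_n$; $\bigcap_n B(\mathcal{T}_n)$ is a single point; and the atoms of $\bigcup_n \mathcal{T}_n$ generate the topology of $X$. Then $\operatorname{rank}(X,T) = \inf \liminf_{n \to +\infty} |\mathcal{A}(\mathcal{T}_n)|$, the infimum over all nested sequences of CKR partitions of $(X,T)$. *)

theory Defs
  imports "HOL-Analysis.Analysis" "HOL-Library.Sublist" "HOL-Library.Extended_Nat"
    "HOL-Library.Liminf_Limsup"
begin

text \<open>Two-sided sequences have type \<^typ>\<open>int \<Rightarrow> nat\<close>, with the product topology of the discrete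
  topology on \<^typ>\<open>nat\<close>; all subshifts considered lie in the functions with values in
  \<open>{0, 1}\<close>.\<close>

definition shift :: "(int \<Rightarrow> 'a) \<Rightarrow> int \<Rightarrow> 'a" where
  "shift x = (\<lambda>i. x (i + 1))"

definition aperiodic_subshift :: "(int \<Rightarrow> 'a) set \<Rightarrow> bool" where
  "aperiodic_subshift X \<longleftrightarrow> X \<noteq> {} \<and> \<not> (\<exists>x\<in>X. \<exists>p>0. (shift ^^ p) x = x)"

subsection \<open>Ferenczi subshifts\<close>

text \<open>The cutting parameters are \<open>q\<close> and the spacer parameters are \<open>a\<close>; the value \<open>a n i\<close> is
  relevant only for \<open>i < q n\<close>.\<close>

fun gen_word :: "(nat \<Rightarrow> nat) \<Rightarrow> (nat \<Rightarrow> nat \<Rightarrow> nat) \<Rightarrow> nat \<Rightarrow> nat list" where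
  "gen_word q a 0 = [0]"
| "gen_word q a (Suc n) =
     concat (map (\<lambda>i. gen_word q a n @ replicate (a n i) 1) [0..<q n]) @ gen_word q a n"

definition ferenczi :: "(nat \<Rightarrow> nat) \<Rightarrow> (nat \<Rightarrow> nat \<Rightarrow> nat) \<Rightarrow> (int \<Rightarrow> nat) set" where
  "ferenczi q a =
     {x. range x \<subseteq> {0, 1} \<and> (\<forall>i j. \<exists>n. sublist (map x [i..j]) (gen_word q a n))}"

definition standard :: "(nat \<Rightarrow> nat) \<Rightarrow> bool" where
  "standard q \<longleftrightarrow> (\<forall>n. q n \<ge> 2)"

definition bounded_spacers :: "(nat \<Rightarrow> nat) \<Rightarrow> (nat \<Rightarrow> nat \<Rightarrow> nat) \<Rightarrow> bool" where
  "bounded_spacers q a \<longleftrightarrow> (\<exists>K. \<forall>n. \<forall>i<q n. a n i \<le> K)"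

definition spacers_from :: "(nat \<Rightarrow> nat) \<Rightarrow> (nat \<Rightarrow> nat \<Rightarrow> nat) \<Rightarrow> nat \<Rightarrow> nat set" where
  "spacers_from q a n = {a N i | N i. N \<ge> n - 1 \<and> i < q N}"

text \<open>The eventual constant value of the decreasing sequence of finite sets
  \<^term>\<open>spacers_from q a n\<close>; it exists when the spacers are bounded (see
  \<open>eventually_spacers_from\<close> below).\<close>

definition limit_spacers :: "(nat \<Rightarrow> nat) \<Rightarrow> (nat \<Rightarrow> nat \<Rightarrow> nat) \<Rightarrow> nat set" where
  "limit_spacers q a = (THE A. \<forall>\<^sub>F n in sequentially. spacers_from q a n = A)"

definition num_limit_spacers :: "(nat \<Rightarrow> nat) \<Rightarrow> (nat \<Rightarrow> nat \<Rightarrow> nat) \<Rightarrow> nat" where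
  "num_limit_spacers q a = card (limit_spacers q a)"

lemma eventually_spacers_from:
  assumes "bounded_spacers q a"
  shows "\<forall>\<^sub>F n in sequentially. spacers_from q a n = limit_spacers q a"
proof -
  let ?A = "spacers_from q a"
  obtain K where K: "\<And>n i. i < q n \<Longrightarrow> a n i \<le> K"
    using assms unfolding bounded_spacers_def by blast
  have fin: "finite (?A n)" for n
    by (rule finite_subset[of _ "{..K}"]) (auto simp: spacers_from_def K)
  have dec: "?A m \<subseteq> ?A n" if "n \<le> m" for m n
    using that unfolding spacers_from_def by force
  obtain n0 where n0: "\<And>m. card (?A n0) \<le> card (?A m)"
    using ex_has_least_nat[of "\<lambda>_. True" 0 "\<lambda>n. card (?A n)"] by auto
  have "?A m = ?A n0" if "n0 \<le> m" for m
    using card_seteq[OF fin dec[OF that] n0] .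
  then have ev: "\<forall>\<^sub>F n in sequentially. ?A n = ?A n0"
    unfolding eventually_sequentially by blast
  have "A = ?A n0" if "\<forall>\<^sub>F n in sequentially. ?A n = A" for A
    using eventually_happens[OF eventually_conj[OF that ev]] by auto
  with ev show ?thesis
    unfolding limit_spacers_def by (rule theI)
qed

subsection \<open>Clopen Kakutani--Rokhlin partitions and topological rank\<close>

text \<open>A finite set of tower labels is, up to relabelling, a finite set of natural numbers.\<close>

record 'x towers =
  labels :: "nat set"
  height :: "nat \<Rightarrow> nat"
  tower_base :: "nat \<Rightarrow> 'x set"

definition levels :: "'x towers \<Rightarrow> (nat \<times> nat) set" where
  "levels P = (SIGMA b:labels P. {..<height P b})"

definition atom :: "('x \<Rightarrow> 'x) \<Rightarrow> 'x towers \<Rightarrow> nat \<times> nat \<Rightarrow> 'x set" where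
  "atom T P = (\<lambda>(b, k). (T ^^ k) ` tower_base P b)"

definition atoms :: "('x \<Rightarrow> 'x) \<Rightarrow> 'x towers \<Rightarrow> 'x set set" where
  "atoms T P = atom T P ` levels P"

definition base :: "'x towers \<Rightarrow> 'x set" where
  "base P = (\<Union>b\<in>labels P. tower_base P b)"

text \<open>Disjointness is required of the indexed family, so that distinct pairs \<open>(b, k)\<close> give
  distinct atoms; as in any partition, the atoms are nonempty.\<close>

definition ckr_partition :: "'x::topological_space set \<Rightarrow> ('x \<Rightarrow> 'x) \<Rightarrow> 'x towers \<Rightarrow> bool" where
  "ckr_partition X T P \<longleftrightarrow>
     finite (labels P) \<and> labels P \<noteq> {} \<and>
     (\<forall>b\<in>labels P. height P b > 0 \<and> tower_base P b \<noteq> {} \<and>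
        openin (top_of_set X) (tower_base P b) \<and> closedin (top_of_set X) (tower_base P b)) \<and>
     disjoint_family_on (atom T P) (levels P) \<and>
     \<Union> (atoms T P) = X"

definition nested_ckr ::
  "'x::topological_space set \<Rightarrow> ('x \<Rightarrow> 'x) \<Rightarrow> (nat \<Rightarrow> 'x towers) \<Rightarrow> bool" where
  "nested_ckr X T P \<longleftrightarrow>
     (\<forall>n. ckr_partition X T (P n)) \<and>
     (\<forall>n. base (P (Suc n)) \<subseteq> base (P n)) \<and>
     (\<forall>n. \<forall>C\<in>atoms T (P (Suc n)). \<exists>D\<in>atoms T (P n). C \<subseteq> D) \<and>
     (\<exists>x. (\<Inter>n. base (P n)) = {x}) \<and>
     topology_generated_by (\<Union>n. atoms T (P n)) = top_of_set X"

text \<open>The rank is \<open>\<infinity>\<close> if there is no nested sequence, or if the lower limit is always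
  infinite.\<close>

definition topological_rank :: "'x::topological_space set \<Rightarrow> ('x \<Rightarrow> 'x) \<Rightarrow> enat" where
  "topological_rank X T =
     (INF P \<in> {P. nested_ckr X T P}. liminf (\<lambda>n. enat (card (labels (P n)))))"

end

theory Submission
  imports Defs
begin

text \<open>A point of the subshift with a zero at the origin is coded by its sequence of spacers, in which
  every level \<open>n\<close> has a Toeplitz structure: outside the holes, which form one class modulo
  \<open>Q n = (q 0 + 1) \<cdots> (q (n - 1) + 1)\<close>, the code agrees with a fixed sequence, and the holes carry the
  spacers of level at least \<open>n\<close>. If two classes of holes were possible, the code would be periodic;
  hence aperiodicity makes the parsing into \<open>gen_word q a n\<close> and spacers unique and the towers over
  \<open>gen_word q a n\<close> followed by \<open>s\<close> ones, \<open>s\<close> a spacer of level at least \<open>n\<close>, form a clopen partition.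
  Cutting each word in its interior turns these partitions into a nested sequence.

  For the lower bound, suppose that a partition of an arbitrary nested sequence has fewer towers than
  there are limit spacers and is fine enough to see the spacer that follows a zero. By linear algebra
  some nonzero weight on the limit spacers sums to zero along each of its towers, so the weight is the
  coboundary of a locally constant function \<open>g\<close>. As \<open>g\<close> is constant on the bases of the towers
  constructed above at high levels, the weight also sums to zero along those. But two of these towers
  at the same level differ in one spacer only, which forces the weight to vanish.\<close>

section \<open>Sequences coded by their spacers\<close>

text \<open>In a code \<open>y\<close>, the entry \<open>y k\<close> is the number of ones between the zeros number \<open>k - 1\<close> and \<open>k\<close>;
  then \<open>psum y k\<close> is the position of zero number \<open>k\<close>, zero number \<open>0\<close> being at the origin.\<close>

definition psum :: "(int \<Rightarrow> nat) \<Rightarrow> int \<Rightarrow> int" where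
  "psum y k = (if 0 \<le> k then \<Sum>j\<in>{1..k}. 1 + int (y j) else - (\<Sum>j\<in>{k+1..0}. 1 + int (y j)))"

lemma psum_0 [simp]: "psum y 0 = 0"
  by (simp add: psum_def)

lemma psum_Suc: "psum y (k + 1) = psum y k + 1 + int (y (k + 1))"
proof (cases "0 \<le> k")
  case True
  then have "{1..k + 1} = insert (k + 1) {1..k}" by auto
  with True show ?thesis by (simp add: psum_def)
next
  case False
  then have "{k + 1..0} = insert (k + 1) {k + 1 + 1..0}" by auto
  with False show ?thesis by (cases "k = - 1") (auto simp add: psum_def)
qed

lemma psum_eqI:
  assumes "p 0 = 0" and "\<And>k. p (k + 1) = p k + 1 + int (y (k + 1))"
  shows "p = psum y"
proof
  fix k
  show "p k = psum y k"
  proof (induction k rule: int_induct[where k = 0])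
    case (step2 i)
    with assms(2)[of "i - 1"] psum_Suc[of y "i - 1"] show ?case by simp
  qed (use assms psum_Suc in auto)
qed

lemma psum_translate: "psum (\<lambda>j. y (j + k)) j = psum y (j + k) - psum y k"
proof -
  have "(\<lambda>j. psum y (j + k) - psum y k) = psum (\<lambda>j. y (j + k))"
    by (rule psum_eqI) (use psum_Suc[of y "_ + k"] in \<open>simp_all add: algebra_simps\<close>)
  then show ?thesis by metis
qed

lemma psum_diff_ge: "k \<le> l \<Longrightarrow> l - k \<le> psum y l - psum y k"
  by (induction l rule: int_ge_induct) (auto simp: psum_Suc)

lemma strict_mono_psum: "strict_mono (psum y)"
  by (rule strict_monoI) (use psum_diff_ge in \<open>smt (verit)\<close>)

lemmas psum_less_iff [simp] = strict_mono_less[OF strict_mono_psum]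
lemmas psum_le_iff [simp] = strict_mono_less_eq[OF strict_mono_psum]

lemma psum_ge: "0 \<le> k \<Longrightarrow> k \<le> psum y k"
  using psum_diff_ge[of 0 k y] by simp

lemma psum_le: "k \<le> 0 \<Longrightarrow> psum y k \<le> k"
  using psum_diff_ge[of k 0 y] by simp

lemma psum_diff_le:
  assumes "\<And>j. y j \<le> K" and "k \<le> l"
  shows "psum y l - psum y k \<le> (int K + 1) * (l - k)"
  using assms(2)
proof (induction l rule: int_ge_induct)
  case (step i)
  have "(int K + 1) * (i + 1 - k) = (int K + 1) * (i - k) + (int K + 1)"
    by (simp add: algebra_simps)
  moreover have "int (y (i + 1)) \<le> int K" using assms(1) by simp
  ultimately show ?case using step(2) psum_Suc[of y i] by linarith
qed simp

lemma abs_psum_le: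
  assumes "\<And>j. y j \<le> K" and "\<bar>k\<bar> \<le> L"
  shows "\<bar>psum y k\<bar> \<le> (int K + 1) * L"
proof -
  have "(int K + 1) * \<bar>k\<bar> \<le> (int K + 1) * L"
    using assms(2) by (intro mult_left_mono) auto
  moreover have "\<bar>psum y k\<bar> \<le> (int K + 1) * \<bar>k\<bar>"
    using psum_diff_le[OF assms(1), of 0 k] psum_diff_le[OF assms(1), of k 0]
      psum_ge[of k y] psum_le[of k y]
    by (cases "0 \<le> k") auto
  ultimately show ?thesis by linarith
qed

lemma psum_sandwich: obtains j where "psum y j \<le> i" "i < psum y (j + 1)"
proof -
  have "\<exists>j. psum y (- \<bar>i\<bar>) \<le> i \<longrightarrow> psum y j \<le> i \<and> i < psum y (j + 1)"
  proof (rule ccontr)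
    assume c: "\<not> ?thesis"
    have "psum y l \<le> i" if "- \<bar>i\<bar> \<le> l" for l
      using that by (induction l rule: int_ge_induct) (use c in \<open>force simp: not_less\<close>)+
    from this[of "\<bar>i\<bar> + 1"] psum_ge[of "\<bar>i\<bar> + 1" y] show False by simp
  qed
  moreover have "psum y (- \<bar>i\<bar>) \<le> i" using psum_le[of "- \<bar>i\<bar>" y] by linarith
  ultimately show ?thesis using that by blast
qed

section \<open>Spelling a code as a 0-1 sequence\<close>

definition spell :: "(int \<Rightarrow> nat) \<Rightarrow> int \<Rightarrow> nat" where
  "spell y i = (if i \<in> range (psum y) then 0 else 1)"

lemma spell_eq_0_iff: "spell y i = 0 \<longleftrightarrow> (\<exists>k. i = psum y k)"
  by (auto simp: spell_def)

lemma spell_range: "spell y i \<in> {0, 1}"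
  by (simp add: spell_def)

lemma spell_psum [simp]: "spell y (psum y k) = 0"
  by (simp add: spell_def)

lemma spell_0 [simp]: "spell y 0 = 0"
  using spell_psum[of y 0] by simp

lemma spell_translate: "spell (\<lambda>j. y (j + k)) i = spell y (i + psum y k)"
proof -
  have "(\<exists>j. i = psum y (j + k) - psum y k) \<longleftrightarrow> (\<exists>j. i + psum y k = psum y j)"
    by (metis diff_add_cancel diff_add_eq eq_diff_eq)
  then show ?thesis
    by (auto simp: spell_def image_iff psum_translate)
qed

lemma spell_between:
  assumes "psum y k < i" "i < psum y (k + 1)"
  shows "spell y i = 1"
proof -
  have "i \<noteq> psum y j" for j
    using assms by auto
  then show ?thesis by (auto simp: spell_def)
qed

lemma spell_gap_right: "d \<le> y (k + 1) \<Longrightarrow> spell y (psum y k + 1 + int d) = 0 \<longleftrightarrow> d = y (k + 1)"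
  using spell_between[of y k "psum y k + 1 + int d"] spell_psum[of y "k + 1"]
  by (cases "d = y (k + 1)") (auto simp: psum_Suc[of y k] simp del: spell_psum)

lemma spell_gap_left: "d \<le> y k \<Longrightarrow> spell y (psum y k - 1 - int d) = 0 \<longleftrightarrow> d = y k"
  using spell_between[of y "k - 1" "psum y k - 1 - int d"] spell_psum[of y "k - 1"]
    psum_Suc[of y "k - 1"]
  by (cases "d = y k") (auto simp del: spell_psum)

section \<open>Windows of a code and windows of its spelling\<close>

lemma psum_cong:
  assumes "\<And>j. l < j \<Longrightarrow> j \<le> m \<Longrightarrow> y j = y' j" and "l \<le> 0" "0 \<le> m" and "l \<le> k" "k \<le> m"
  shows "psum y k = psum y' k"
proof (cases "0 \<le> k")
  case True
  then show ?thesis using assms(4,5)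
  proof (induction k rule: int_ge_induct)
    case (step i)
    then show ?case using assms(1)[of "i + 1"] assms(2,3) by (simp add: psum_Suc)
  qed simp
next
  case False
  then have "k \<le> 0" by simp
  then show ?thesis using assms(4,5)
  proof (induction k rule: int_le_induct)
    case (step i)
    then show ?case using assms(1)[of i] assms(2,3) psum_Suc[of y "i - 1"] psum_Suc[of y' "i - 1"]
      by simp
  qed simp
qed

lemma spell_cong:
  assumes y: "\<And>j. l < j \<Longrightarrow> j \<le> m \<Longrightarrow> y j = y' j" and lm: "l \<le> 0" "0 \<le> m"
    and i: "psum y l \<le> i" "i \<le> psum y m"
  shows "spell y i = spell y' i"
proof -
  have p: "psum y k = psum y' k" if "l \<le> k" "k \<le> m" for k
    using psum_cong[OF y lm that] .
  have "(\<exists>k. i = psum y k) \<longleftrightarrow> (\<exists>k. i = psum y' k)"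
  proof safe
    fix k assume k: "i = psum y k"
    with i have "l \<le> k" "k \<le> m" by simp_all
    with k p show "\<exists>k'. psum y k = psum y' k'" by blast
  next
    fix k assume k: "i = psum y' k"
    with i p[of l] p[of m] lm have "l \<le> k" "k \<le> m" by simp_all
    with k p show "\<exists>k'. psum y' k = psum y k'" by metis
  qed
  then show ?thesis by (auto simp: spell_def)
qed

lemma spell_cong_abs:
  assumes "\<And>j. \<bar>j\<bar> \<le> L \<Longrightarrow> y j = y' j" and "\<bar>i\<bar> \<le> L"
  shows "spell y i = spell y' i"
proof -
  have "0 \<le> L" using assms(2) by linarith
  then have "psum y (- L) \<le> i" "i \<le> psum y L"
    using assms(2) psum_ge[of L y] psum_le[of "- L" y] by linarith+
  with \<open>0 \<le> L\<close> show ?thesis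
    by (intro spell_cong[of "- L" L] assms(1)) auto
qed

text \<open>The zeros are traced one by one outwards from the origin, in both directions; the
  inspected window is bounded by zeros of \<open>y\<close> alone.\<close>

lemma psum_determined:
  assumes eq: "\<And>i. psum y l \<le> i \<Longrightarrow> i \<le> psum y m \<Longrightarrow> spell y i = spell y' i"
    and lm: "l \<le> 0" "0 \<le> m" and k: "l \<le> k" "k \<le> m"
  shows "psum y k = psum y' k"
proof (cases "0 \<le> k")
  case True
  then show ?thesis using k
  proof (induction k rule: int_ge_induct)
    case (step i)
    then have IH: "psum y i = psum y' i" using lm by simp
    \<comment> \<open>One of the two spellings has its next zero after exactly \<open>d\<close>
      ones, inside the window, so the other has a zero there too and both spacers equal
      \<open>d\<close>.\<close>
    define d where "d = min (y (i + 1)) (y' (i + 1))"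
    have "psum y l \<le> psum y i" "psum y (i + 1) \<le> psum y m"
      using step.prems step.hyps lm unfolding psum_le_iff by linarith+
    moreover have "d \<le> y (i + 1)" by (simp add: d_def)
    ultimately have "spell y (psum y i + 1 + int d) = spell y' (psum y i + 1 + int d)"
      using psum_Suc[of y i] by (intro eq; linarith)
    then have "y (i + 1) = y' (i + 1)"
      using spell_gap_right[of d y i] spell_gap_right[of d y' i] IH
      by (auto simp: d_def min_def split: if_splits)
    with IH show ?case by (simp add: psum_Suc)
  qed simp
next
  case False
  then have "k \<le> 0" by simp
  then show ?thesis using k
  proof (induction k rule: int_le_induct)
    case (step i)
    then have IH: "psum y i = psum y' i" using lm by simp
    define d where "d = min (y i) (y' i)"
    have s: "psum y i = psum y (i - 1) + 1 + int (y i)" "psum y' i = psum y' (i - 1) + 1 + int (y' i)"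
      using psum_Suc[of _ "i - 1"] by simp_all
    have "psum y l \<le> psum y (i - 1)" "psum y i \<le> psum y m"
      using step.prems step.hyps lm unfolding psum_le_iff by linarith+
    moreover have "d \<le> y i" by (simp add: d_def)
    ultimately have "spell y (psum y i - 1 - int d) = spell y' (psum y i - 1 - int d)"
      using s by (intro eq; linarith)
    then have "y i = y' i"
      using spell_gap_left[of d y i] spell_gap_left[of d y' i] IH
      by (auto simp: d_def min_def split: if_splits)
    with IH s show ?case by simp
  qed simp
qed

text \<open>With spacers of \<open>y\<close> at most \<open>K\<close>, its zeros numbered
  \<open>- (L + 1)\<close> to \<open>L + 1\<close> lie within this radius. An entry is read off from
  the zero at its index and the one before it, hence \<open>L + 1\<close> instead of
  \<open>L\<close>.\<close>

lemma spell_determines: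
  assumes "\<And>j. y j \<le> K" and "0 \<le> L"
    and "\<And>i. \<bar>i\<bar> \<le> (int K + 1) * (L + 1) \<Longrightarrow> spell y i = spell y' i" and "\<bar>k\<bar> \<le> L"
  shows "y k = y' k"
proof -
  have "\<bar>psum y (- (L + 1))\<bar> \<le> (int K + 1) * (L + 1)" "\<bar>psum y (L + 1)\<bar> \<le> (int K + 1) * (L + 1)"
    using assms(2) by (auto intro: abs_psum_le[OF assms(1)])
  then have "psum y j = psum y' j" if "\<bar>j\<bar> \<le> L + 1" for j
    using that assms(2) by (intro psum_determined[of y "- (L + 1)" "L + 1"] assms(3)) auto
  from this[of k] this[of "k - 1"] assms(4) show ?thesis
    using psum_Suc[of y "k - 1"] psum_Suc[of y' "k - 1"] by simp
qed

lemma inj_spell: "inj spell"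
proof (rule injI, rule ext)
  fix y y' k
  assume "spell y = spell y'"
  then have "psum y j = psum y' j" for j
    using psum_determined[of y "- \<bar>j\<bar>" "\<bar>j\<bar>" y' j] by simp
  then show "y k = y' k"
    using psum_Suc[of y "k - 1"] psum_Suc[of y' "k - 1"] by simp
qed

lemma map_spell_upto:
  assumes "0 \<le> m"
  shows "map (spell y) [0..psum y m] = 0 # concat (map (\<lambda>j. replicate (y j) 1 @ [0]) [1..m])"
  using assms
proof (induction m rule: int_ge_induct)
  case (step m)
  have "[0..psum y (m + 1)] = [0..psum y m] @ [psum y m + 1..psum y (m + 1) - 1] @ [psum y (m + 1)]"
    using psum_ge[OF step(1), of y] psum_Suc[of y m] step(1)
      upto_split2[of 0 "psum y m" "psum y (m + 1)"] upto_rec2[of "psum y m + 1" "psum y (m + 1)"]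
    by simp
  moreover have "map (spell y) [psum y m + 1..psum y (m + 1) - 1] = replicate (y (m + 1)) 1"
    by (rule nth_equalityI) (auto simp: psum_Suc[of y m] spell_between[of y m])
  moreover have "[1..m + 1] = [1..m] @ [m + 1]" using step(1) by (simp add: upto_rec2)
  ultimately show ?case using step(2) by simp
qed simp

section \<open>The Toeplitz sequence of spacers\<close>

locale ferenczi_parameters =
  fixes q :: "nat \<Rightarrow> nat" and a :: "nat \<Rightarrow> nat \<Rightarrow> nat"
  assumes std: "standard q" and bdd: "bounded_spacers q a"
begin

text \<open>The number of zeros in \<open>gen_word q a n\<close>.\<close>

definition Q :: "nat \<Rightarrow> int" where
  "Q n = (\<Prod>i<n. int (q i) + 1)"

lemma Q_0 [simp]: "Q 0 = 1"
  by (simp add: Q_def)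

lemma Q_Suc: "Q (Suc n) = Q n * (int (q n) + 1)"
  by (simp add: Q_def)

lemma Q_pos [simp]: "0 < Q n"
  unfolding Q_def by (rule prod_pos) auto

lemma Q_dvd: "n \<le> m \<Longrightarrow> Q n dvd Q m"
  by (induction m rule: dec_induct) (auto simp: Q_Suc)

lemma Q_ge: "3 * Q n \<le> Q (Suc n)"
proof -
  have "3 \<le> int (q n) + 1" using std by (auto simp: standard_def)
  then have "Q n * 3 \<le> Q n * (int (q n) + 1)"
    by (rule mult_left_mono) (simp add: less_imp_le)
  then show ?thesis by (simp add: Q_Suc)
qed

lemma Q_gt: "int n < Q n"
proof (induction n)
  case (Suc n)
  then show ?case using Q_ge[of n] by simp
qed simp

text \<open>An offset that is consistent between levels: all later values are congruent to
  \<open>hole n\<close> modulo \<open>Q n\<close>, while \<open>hole n\<close> and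
  \<open>Q n - hole n\<close> both tend to infinity.\<close>

definition hole :: "nat \<Rightarrow> int" where
  "hole n = (\<Sum>i<n. Q i)"

lemma hole_Suc: "hole (Suc n) = hole n + Q n"
  by (simp add: hole_def)

lemma hole_ge: "int n \<le> hole n"
proof (induction n)
  case (Suc n)
  then show ?case using Q_pos[of n] by (simp add: hole_Suc del: Q_pos)
qed (simp add: hole_def)

lemma hole_le: "2 * hole n + 1 \<le> Q n"
proof (induction n)
  case (Suc n)
  then show ?case using Q_ge[of n] by (simp add: hole_Suc)
qed (simp add: hole_def)

lemma hole_cong: "n \<le> m \<Longrightarrow> Q n dvd hole m - hole n"
proof (induction m rule: dec_induct)
  case (step m)
  then have "Q n dvd (hole m - hole n) + Q m" using Q_dvd by (intro dvd_add) auto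
  then show ?case by (simp add: hole_Suc algebra_simps)
qed simp

text \<open>\<open>Suc\<close> cancels the offset in \<open>spacers_from\<close>: these are the
  spacers of levels \<open>N \<ge> n\<close>.\<close>

abbreviation spacers :: "nat \<Rightarrow> nat set" where
  "spacers n \<equiv> spacers_from q a (Suc n)"

lemma spacersI: "n \<le> N \<Longrightarrow> i < q N \<Longrightarrow> a N i \<in> spacers n"
  by (auto simp: spacers_from_def)

lemma spacersE:
  assumes "s \<in> spacers n" obtains N i where "n \<le> N" "i < q N" "s = a N i"
  using assms by (auto simp: spacers_from_def)

lemma spacers_antimono: "n \<le> m \<Longrightarrow> spacers m \<subseteq> spacers n"
  by (force simp: spacers_from_def)

definition K :: nat where
  "K = (SOME K. \<forall>n. \<forall>i<q n. a n i \<le> K)"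

lemma a_le: "i < q n \<Longrightarrow> a n i \<le> K"
  using someI_ex[OF bdd[unfolded bounded_spacers_def]] unfolding K_def by blast

lemma spacers_le: "s \<in> spacers n \<Longrightarrow> s \<le> K"
  by (auto simp: spacers_from_def a_le)

lemma finite_spacers [simp]: "finite (spacers n)"
  by (rule finite_subset[of _ "{..K}"]) (auto dest: spacers_le)

lemma q_pos: "0 < q n"
  using std unfolding standard_def by (meson less_le_trans pos2)

lemma spacers_nonempty: "spacers n \<noteq> {}"
  using spacersI[OF order_refl q_pos] by blast

text \<open>For \<open>k \<noteq> 0\<close> the largest \<open>n\<close> with
  \<open>Q n dvd k\<close>, that is, the level at which the spacer before zero number
  \<open>k\<close> is inserted.\<close>

definition lev :: "int \<Rightarrow> nat" where
  "lev k = (LEAST n. \<not> Q (Suc n) dvd k)"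

text \<open>At \<open>k > 0\<close>, this is the spacer before zero number \<open>k\<close> in the limit of the generating words. The
  formula is also used for \<open>k < 0\<close>; the value at \<open>0\<close>, which no level decides, is junk.\<close>

definition toep :: "int \<Rightarrow> nat" where
  "toep k = (if k = 0 then 0
     else a (lev k) (nat (k div Q (lev k) mod (int (q (lev k)) + 1)) - 1))"

lemma Q_lev_not_dvd: "k \<noteq> 0 \<Longrightarrow> \<not> Q (Suc (lev k)) dvd k"
proof -
  assume "k \<noteq> 0"
  then have "\<not> Q (Suc (nat \<bar>k\<bar>)) dvd k"
    using zdvd_imp_le[of "Q (Suc (nat \<bar>k\<bar>))" "\<bar>k\<bar>"] Q_gt[of "Suc (nat \<bar>k\<bar>)"] by auto
  then show ?thesis unfolding lev_def by (rule LeastI)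
qed

lemma Q_lev_dvd: "n \<le> lev k \<Longrightarrow> Q n dvd k"
  using not_less_Least[of "n - 1" "\<lambda>n. \<not> Q (Suc n) dvd k"]
  by (cases n) (auto simp: lev_def)

lemma lev_eqI: "Q n dvd k \<Longrightarrow> \<not> Q (Suc n) dvd k \<Longrightarrow> lev k = n"
  unfolding lev_def
proof (rule Least_equality)
  fix m assume "Q n dvd k" "\<not> Q (Suc m) dvd k"
  then show "n \<le> m" using Q_dvd[of "Suc m" n] dvd_trans by (metis not_less_eq_eq)
qed

lemma toep_in_spacers:
  assumes "Q n dvd k" "k \<noteq> 0"
  shows "toep k \<in> spacers n"
proof -
  define N where "N = lev k"
  have N: "Q N dvd k" "\<not> Q (Suc N) dvd k"
    using assms Q_lev_dvd Q_lev_not_dvd by (auto simp: N_def)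
  have "n \<le> N" using N(2) assms(1) Q_dvd[of "Suc N" n] dvd_trans by (metis not_less_eq_eq)
  \<comment> \<open>\<open>r\<close> is the digit of \<open>k\<close> at its level; it is nonzero
    because \<open>Q (Suc N)\<close> does not divide \<open>k\<close>, and digit
    \<open>i + 1\<close> selects \<open>a N i\<close>.\<close>
  define r where "r = k div Q N mod (int (q N) + 1)"
  have "r \<noteq> 0"
  proof
    assume "r = 0"
    then have "int (q N) + 1 dvd k div Q N" by (simp add: r_def dvd_eq_mod_eq_0)
    then have "Q N * (int (q N) + 1) dvd Q N * (k div Q N)" by (rule mult_dvd_mono[OF dvd_refl])
    with N show False by (simp add: Q_Suc)
  qed
  moreover have "0 \<le> r" "r < int (q N) + 1"
    unfolding r_def by (rule pos_mod_sign pos_mod_bound; simp)+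
  ultimately have "nat r - 1 < q N" by linarith
  with \<open>n \<le> N\<close> have "a N (nat r - 1) \<in> spacers n" by (rule spacersI)
  with assms show ?thesis by (simp add: toep_def N_def r_def)
qed

lemma toep_le: "toep k \<le> K"
  using toep_in_spacers[of 0 k] spacers_le by (cases "k = 0") (auto simp: toep_def)

text \<open>The level \<open>N\<close> of \<open>k\<close> is below \<open>n\<close>, and both this
  level and the digit that selects the spacer depend on \<open>k\<close> modulo
  \<open>Q (Suc N)\<close> only, which divides \<open>Q n\<close>.\<close>

lemma toep_cong:
  assumes "\<not> Q n dvd k" "Q n dvd k' - k"
  shows "toep k' = toep k"
proof -
  from assms(2) obtain j where "k' - k = Q n * j" ..
  then have j: "k' = k + Q n * j" by simp
  define N where "N = lev k"
  have "k \<noteq> 0" "k' \<noteq> 0" using assms by auto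
  have N: "Q N dvd k" "\<not> Q (Suc N) dvd k"
    using \<open>k \<noteq> 0\<close> Q_lev_dvd Q_lev_not_dvd by (auto simp: N_def)
  have "Suc N \<le> n" using N(1) assms(1) Q_dvd[of n N] dvd_trans by (metis not_less_eq_eq)
  then obtain t where t: "Q n = Q (Suc N) * t" using Q_dvd by (blast elim: dvdE)
  have "Q N dvd k'" using N(1) by (simp add: j t Q_Suc)
  moreover have "\<not> Q (Suc N) dvd k'"
    using N(2) by (simp add: j t dvd_add_left_iff mult.assoc)
  ultimately have "lev k' = N" by (rule lev_eqI)
  have "k' = k + Q N * ((int (q N) + 1) * (t * j))" by (simp add: j t Q_Suc mult.assoc)
  then have "k' div Q N = k div Q N + (int (q N) + 1) * (t * j)"
    using less_imp_neq[OF Q_pos[of N]] by simp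
  then show ?thesis
    using \<open>k \<noteq> 0\<close> \<open>k' \<noteq> 0\<close> \<open>lev k' = N\<close> by (simp add: toep_def N_def)
qed

lemma toep_mult:
  assumes "i < q n"
  shows "toep (Q n * (int i + 1)) = a n i"
proof -
  have "\<not> Q n * (int (q n) + 1) dvd Q n * (int i + 1)"
    using assms less_imp_neq[OF Q_pos[of n]] by (auto dest: zdvd_imp_le)
  then have "lev (Q n * (int i + 1)) = n"
    by (intro lev_eqI) (auto simp: Q_Suc)
  then show ?thesis
    using assms by (simp add: toep_def less_imp_neq[OF Q_pos, symmetric] nat_add_distrib)
qed

lemma gen_word_eq_map: "gen_word q a n = map (spell toep) [0..psum toep (Q n - 1)]"
proof -
  define blk where "blk j = replicate (toep j) (1::nat) @ [0]" for j
  have "gen_word q a n = 0 # concat (map blk [1..Q n - 1])"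
  proof (induction n)
    case (Suc n)
    define w where "w = gen_word q a n"
    \<comment> \<open>Strictly between consecutive multiples of \<open>Q n\<close> no index is
      divisible by \<open>Q n\<close>, so \<open>toep_cong\<close> makes every copy of the word of
      level \<open>n\<close> repeat the first.\<close>
    have rep: "map blk [Q n * (int i + 1) + 1..Q n * (int i + 2) - 1] = map blk [1..Q n - 1]" for i
    proof (rule nth_equalityI)
      fix j
      assume "j < length (map blk [Q n * (int i + 1) + 1..Q n * (int i + 2) - 1])"
      then have j: "int j < Q n - 1" by (simp add: algebra_simps)
      have "\<not> Q n dvd 1 + int j" using j zdvd_imp_le[of "Q n" "1 + int j"] by auto
      then have "toep (Q n * (int i + 1) + 1 + int j) = toep (1 + int j)"
        by (rule toep_cong) (simp add: algebra_simps)
      with j show "map blk [Q n * (int i + 1) + 1..Q n * (int i + 2) - 1] ! j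
          = map blk [1..Q n - 1] ! j"
        by (simp add: blk_def nth_upto algebra_simps)
    qed (simp add: algebra_simps)
    \<comment> \<open>Induction on the number of spacers of level \<open>n\<close> already placed;
      \<open>i = q n\<close> gives the recursion of \<open>gen_word\<close>.\<close>
    have "0 # concat (map blk [1..Q n * (int i + 1) - 1]) =
        concat (map (\<lambda>i. w @ replicate (a n i) 1) [0..<i]) @ w" if "i \<le> q n" for i
      using that
    proof (induction i)
      case 0
      then show ?case using Suc.IH by (simp add: w_def)
    next
      case (Suc i)
      have "0 < Q n * (int i + 1)" by (rule mult_pos_pos) auto
      then have "1 \<le> Q n * (int i + 1)" by linarith
      moreover have "Q n * (int i + 1) \<le> Q n * (int i + 2) - 1"
        using Q_pos[of n] by (simp add: algebra_simps del: Q_pos)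
      ultimately have "[1..Q n * (int i + 2) - 1] =
          [1..Q n * (int i + 1) - 1] @ [Q n * (int i + 1)]
          @ [Q n * (int i + 1) + 1..Q n * (int i + 2) - 1]"
        using upto_split3[of 1 "Q n * (int i + 1)" "Q n * (int i + 2) - 1"] by auto
      then have "0 # concat (map blk [1..Q n * (int i + 2) - 1]) =
          (0 # concat (map blk [1..Q n * (int i + 1) - 1])) @ blk (Q n * (int i + 1))
          @ concat (map blk [1..Q n - 1])"
        by (simp add: rep)
      also have "\<dots> = (concat (map (\<lambda>i. w @ replicate (a n i) 1) [0..<i]) @ w)
          @ replicate (a n i) 1 @ w"
      proof -
        have "0 # concat (map blk [1..Q n * (int i + 1) - 1]) =
            concat (map (\<lambda>i. w @ replicate (a n i) 1) [0..<i]) @ w"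
          using Suc by simp
        moreover have "blk (Q n * (int i + 1)) = replicate (a n i) 1 @ [0]"
          using Suc.prems by (simp add: blk_def toep_mult)
        moreover have "w = 0 # concat (map blk [1..Q n - 1])"
          using \<open>gen_word q a n = _\<close> by (simp add: w_def)
        ultimately show ?thesis by simp
      qed
      finally show ?case by (simp add: add.commute[of _ "2::int"])
    qed
    from this[of "q n"] show ?case by (simp add: w_def Q_Suc)
  qed simp
  with map_spell_upto[of "Q n - 1" toep] Q_pos[of n] show ?thesis
    unfolding blk_def by simp
qed

end

section \<open>Points of the subshift and their phases\<close>

lemma shift_funpow: "(shift ^^ m) x = (\<lambda>i. x (i + int m))"
  by (induction m) (auto simp: shift_def algebra_simps)

context ferenczi_parameters
begin

section \<open>Windows of points and their codes\<close>

abbreviation X :: "(int \<Rightarrow> nat) set" where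
  "X \<equiv> ferenczi q a"

text \<open>All generating words are prefixes of \<open>spell toep\<close>, so their factors are its
  windows at nonnegative positions; \<open>t \<ge> int L\<close> confines the window to
  these.\<close>

lemma ferenczi_iff:
  "x \<in> X \<longleftrightarrow> (\<forall>L::nat. \<exists>t\<ge>int L. \<forall>i. \<bar>i\<bar> \<le> int L \<longrightarrow> x i = spell toep (t + i))"
    (is "_ \<longleftrightarrow> ?R")
proof
  assume x: "x \<in> X"
  show ?R
  proof
    fix L :: nat
    obtain n where "sublist (map x [- int L..int L]) (gen_word q a n)"
      using x unfolding ferenczi_def by blast
    then obtain ps ss where eq: "map (spell toep) [0..psum toep (Q n - 1)] = ps @ map x [- int L..int L] @ ss"
      unfolding gen_word_eq_map sublist_def by blast
    have "x i = spell toep (int (length ps) + int L + i)" if "\<bar>i\<bar> \<le> int L" for i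
    proof -
      define j where "j = nat (i + int L)"
      have j: "int j = i + int L" "j < nat (2 * int L + 1)" using that by (auto simp: j_def)
      then have "(ps @ map x [- int L..int L] @ ss) ! (length ps + j) = x i"
        using that by (auto simp: nth_append nth_upto)
      moreover have "length ps + j < length (ps @ map x [- int L..int L] @ ss)"
        using j that by simp
      then have "(map (spell toep) [0..psum toep (Q n - 1)]) ! (length ps + j) = spell toep (int (length ps) + j)"
        unfolding eq[symmetric] by (simp add: nth_upto)
      ultimately show ?thesis using j eq by (simp add: algebra_simps)
    qed
    then show "\<exists>t\<ge>int L. \<forall>i. \<bar>i\<bar> \<le> int L \<longrightarrow> x i = spell toep (t + i)"
      by (intro exI[of _ "int (length ps) + int L"]) auto
  qed
next
  assume R: ?R
  have "x i \<in> {0, 1}" for i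
  proof -
    obtain t where "x i = spell toep (t + i)" using R[rule_format, of "nat \<bar>i\<bar>"] by auto
    then show ?thesis using spell_range by metis
  qed
  moreover have "\<exists>n. sublist (map x [i..j]) (gen_word q a n)" for i j
  proof (cases "i \<le> j")
    case True
    obtain t where t: "t \<ge> \<bar>i\<bar> + \<bar>j\<bar>"
        "\<And>k. \<bar>k\<bar> \<le> \<bar>i\<bar> + \<bar>j\<bar> \<Longrightarrow> x k = spell toep (t + k)"
      using R[rule_format, of "nat (\<bar>i\<bar> + \<bar>j\<bar>)"] by auto
    define n where "n = nat (t + j)"
    define m where "m = psum toep (Q n - 1)"
    have "t + j \<le> m"
      using Q_gt[of n] psum_ge[of "Q n - 1" toep] t(1) unfolding m_def n_def by linarith
    then have "[0..m] = [0..t + i - 1] @ [t + i..t + j] @ [t + j + 1..m]"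
      using upto_split1[of 0 "t + i" m] upto_split2[of "t + i" "t + j" m] t(1) True by simp
    moreover have "map x [i..j] = map (spell toep) [t + i..t + j]"
    proof (rule nth_equalityI)
      fix k assume "k < length (map x [i..j])"
      with t(2)[of "i + int k"] show "map x [i..j] ! k = map (spell toep) [t + i..t + j] ! k"
        by (simp add: nth_upto algebra_simps)
    qed simp
    ultimately have "gen_word q a n = map (spell toep) [0..t + i - 1] @ map x [i..j]
        @ map (spell toep) [t + j + 1..m]"
      by (simp add: gen_word_eq_map m_def)
    then show ?thesis unfolding sublist_def by blast
  qed simp
  ultimately show "x \<in> X" unfolding ferenczi_def by (simp add: image_subset_iff)
qed

lemma X_translate:
  assumes "x \<in> X"
  shows "(\<lambda>i. x (i + m)) \<in> X"
  unfolding ferenczi_iff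
proof
  fix L :: nat
  obtain t where t: "t \<ge> int (L + nat \<bar>m\<bar>)"
      "\<And>i. \<bar>i\<bar> \<le> int (L + nat \<bar>m\<bar>) \<Longrightarrow> x i = spell toep (t + i)"
    using assms unfolding ferenczi_iff by blast
  have "x (i + m) = spell toep (t + m + i)" if "\<bar>i\<bar> \<le> int L" for i
    using t(2)[of "i + m"] that by (simp add: algebra_simps)
  then show "\<exists>t\<ge>int L. \<forall>i. \<bar>i\<bar> \<le> int L \<longrightarrow> x (i + m) = spell toep (t + i)"
    using t(1) by (intro exI[of _ "t + m"]) auto
qed

text \<open>The codes of the points with a zero at the origin. The strict bound
  \<open>t > int L\<close> keeps \<open>t + k\<close> positive and so away from the junk value of
  \<open>toep\<close> at \<open>0\<close>.\<close>

definition Y :: "(int \<Rightarrow> nat) set" where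
  "Y = {y. \<forall>L::nat. \<exists>t>int L. \<forall>k. \<bar>k\<bar> \<le> int L \<longrightarrow> y k = toep (t + k)}"

lemma YE:
  assumes "y \<in> Y"
  obtains t where "t > L" "\<And>k. \<bar>k\<bar> \<le> L \<Longrightarrow> y k = toep (t + k)"
proof -
  obtain t where t: "t > int (nat \<bar>L\<bar>)" "\<And>k. \<bar>k\<bar> \<le> int (nat \<bar>L\<bar>) \<Longrightarrow> y k = toep (t + k)"
    using assms unfolding Y_def by blast
  show ?thesis
  proof (rule that[of t])
    show "t > L" using t(1) by linarith
    show "y k = toep (t + k)" if "\<bar>k\<bar> \<le> L" for k using that by (intro t(2)) linarith
  qed
qed

lemma Y_le:
  assumes "y \<in> Y"
  shows "y k \<le> K"
proof -
  obtain t where "y k = toep (t + k)" using YE[OF assms, of "\<bar>k\<bar>"] by auto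
  then show ?thesis by (simp add: toep_le)
qed

lemma Y_translate:
  assumes "y \<in> Y"
  shows "(\<lambda>j. y (j + m)) \<in> Y"
  unfolding Y_def
proof safe
  fix L :: nat
  obtain t where t: "t > int L + \<bar>m\<bar>" "\<And>i. \<bar>i\<bar> \<le> int L + \<bar>m\<bar> \<Longrightarrow> y i = toep (t + i)"
    using YE[OF assms] by metis
  have "y (i + m) = toep (t + m + i)" if "\<bar>i\<bar> \<le> int L" for i
    using t(2)[of "i + m"] that by (simp add: algebra_simps)
  then show "\<exists>t>int L. \<forall>i. \<bar>i\<bar> \<le> int L \<longrightarrow> y (i + m) = toep (t + i)"
    using t(1) by (intro exI[of _ "t + m"]) auto
qed

lemma spell_in_X:
  assumes "y \<in> Y"
  shows "spell y \<in> X"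
  unfolding ferenczi_iff
proof
  fix L :: nat
  obtain t where t: "t > int L" "\<And>k. \<bar>k\<bar> \<le> int L \<Longrightarrow> y k = toep (t + k)"
    using YE[OF assms] by metis
  have "spell y i = spell toep (psum toep t + i)" if "\<bar>i\<bar> \<le> int L" for i
    using spell_cong_abs[of "int L" y "\<lambda>k. toep (k + t)" i] t(2) that
    by (simp add: spell_translate add.commute)
  moreover have "int L \<le> psum toep t" using psum_ge[of t toep] t(1) by simp
  ultimately show "\<exists>t\<ge>int L. \<forall>i. \<bar>i\<bar> \<le> int L \<longrightarrow> spell y i = spell toep (t + i)" by blast
qed

text \<open>Every window of \<open>x\<close> is coded by a translate of \<^const>\<open>toep\<close>. As a window determines the entries
  near the origin, these translates converge to a code of \<open>x\<close>.\<close>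

lemma X_spell:
  assumes x: "x \<in> X" and "x 0 = 0"
  obtains y where "y \<in> Y" "x = spell y"
proof -
  define R where "R L = (int K + 1) * (L + 1)" for L
  have "\<exists>t>L. \<forall>i. \<bar>i\<bar> \<le> R L \<longrightarrow> x i = spell (\<lambda>j. toep (j + t)) i" if "0 \<le> L" for L
  proof -
    have "0 \<le> R L" using that by (simp add: R_def)
    then obtain p where p: "p \<ge> R L" "\<And>i. \<bar>i\<bar> \<le> R L \<Longrightarrow> x i = spell toep (p + i)"
      using x[unfolded ferenczi_iff, rule_format, of "nat (R L)"] by auto
    from p(2)[of 0] \<open>0 \<le> R L\<close> \<open>x 0 = 0\<close> obtain t where t: "p = psum toep t"
      by (auto simp: spell_eq_0_iff)
    have "L < t"
    proof (rule ccontr)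
      assume "\<not> L < t"
      then have "psum toep t \<le> psum toep L" by simp
      also have "\<dots> \<le> (int K + 1) * L" using psum_diff_le[OF toep_le that] by simp
      also have "\<dots> < R L" by (simp add: R_def algebra_simps)
      finally show False using p(1) t by simp
    qed
    with p(2) show ?thesis by (auto simp: spell_translate t add.commute)
  qed
  then obtain T where T: "\<And>L. 0 \<le> L \<Longrightarrow> T L > L"
      "\<And>L i. 0 \<le> L \<Longrightarrow> \<bar>i\<bar> \<le> R L \<Longrightarrow> x i = spell (\<lambda>j. toep (j + T L)) i"
    by metis
  \<comment> \<open>The limit code is built diagonally: the window chosen for
    \<open>\<bar>k\<bar>\<close> already settles entry \<open>k\<close>.\<close>
  define y where "y k = toep (k + T \<bar>k\<bar>)" for k
  have y: "y k = toep (k + T L)" if "\<bar>k\<bar> \<le> L" for k L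
  proof -
    have le: "R \<bar>k\<bar> \<le> R L" using that unfolding R_def by (intro mult_left_mono) auto
    have "spell (\<lambda>j. toep (j + T \<bar>k\<bar>)) i = spell (\<lambda>j. toep (j + T L)) i" if "\<bar>i\<bar> \<le> R \<bar>k\<bar>" for i
      using T(2)[of "\<bar>k\<bar>" i] T(2)[of L i] that le \<open>\<bar>k\<bar> \<le> L\<close> by simp
    then show ?thesis
      unfolding y_def R_def
      by (intro spell_determines[of "\<lambda>j. toep (j + T \<bar>k\<bar>)" K "\<bar>k\<bar>"]) (auto simp: toep_le)
  qed
  have "y \<in> Y"
    unfolding Y_def
  proof safe
    fix L :: nat
    show "\<exists>t>int L. \<forall>k. \<bar>k\<bar> \<le> int L \<longrightarrow> y k = toep (t + k)"
      using T(1)[of "int L"] y[of _ "int L"] by (auto intro!: exI[of _ "T (int L)"] simp: add.commute)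
  qed
  moreover have "x = spell y"
  proof
    fix i
    have "1 * (\<bar>i\<bar> + 1) \<le> R \<bar>i\<bar>" unfolding R_def by (rule mult_right_mono) auto
    then have "\<bar>i\<bar> \<le> R \<bar>i\<bar>" by (rule order_trans[rotated]) simp
    then have "x i = spell (\<lambda>j. toep (j + T \<bar>i\<bar>)) i" by (intro T(2)) auto
    also have "\<dots> = spell y i" using y by (intro spell_cong_abs[of "\<bar>i\<bar>"]) auto
    finally show "x i = spell y i" .
  qed
  ultimately show ?thesis by (rule that)
qed

text \<open>The spacers are bounded, so every point has a zero near the origin; translating it to
  the origin reduces to \<open>X_spell\<close>.\<close>

lemma X_translated_spell:
  assumes "x \<in> X"
  obtains y i where "y \<in> Y" "x = (\<lambda>j. spell y (j + i))"
proof -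
  obtain t where t: "t \<ge> int (Suc K)" "\<And>i. \<bar>i\<bar> \<le> int (Suc K) \<Longrightarrow> x i = spell toep (t + i)"
    using assms unfolding ferenczi_iff by blast
  obtain j where j: "psum toep j \<le> t" "t < psum toep (j + 1)" by (rule psum_sandwich)
  then have "\<bar>psum toep j - t\<bar> \<le> int (Suc K)"
    using psum_Suc[of toep j] toep_le[of "j + 1"] by simp
  then have 0: "x (psum toep j - t) = 0" using t(2)[of "psum toep j - t"] by simp
  define m where "m = psum toep j - t"
  obtain y where "y \<in> Y" "(\<lambda>i. x (i + m)) = spell y"
    using X_spell[OF X_translate[OF assms, of m]] 0 by (auto simp: m_def)
  moreover have "x = (\<lambda>j. spell y (j + - m))"
  proof
    show "x j = spell y (j + - m)" for j
      using fun_cong[OF calculation(2), of "j - m"] by simp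
  qed
  ultimately show ?thesis using that by blast
qed

section \<open>Phases: the residue classes of the holes\<close>

definition phased :: "nat \<Rightarrow> int \<Rightarrow> (int \<Rightarrow> nat) \<Rightarrow> bool" where
  "phased n c y \<longleftrightarrow> (\<forall>k. if Q n dvd k - c then y k \<in> spacers n else y k = toep (k - c))"

lemma phasedD: "phased n c y \<Longrightarrow> \<not> Q n dvd k - c \<Longrightarrow> y k = toep (k - c)"
  by (metis phased_def)

lemma phased_spacers: "phased n c y \<Longrightarrow> Q n dvd k - c \<Longrightarrow> y k \<in> spacers n"
  by (metis phased_def)

lemma phased_cong:
  assumes "phased n c y" "Q n dvd c' - c"
  shows "phased n c' y"
proof -
  have d: "Q n dvd k - c \<longleftrightarrow> Q n dvd k - c'" for k
    using dvd_add_left_iff[OF assms(2), of "k - c'"] by simp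
  have "toep (k - c') = toep (k - c)" if "\<not> Q n dvd k - c" for k
    using that assms(2) dvd_minus_iff[of "Q n" "c' - c"]
    by (intro toep_cong) (simp_all del: dvd_minus_iff)
  with assms(1) d show ?thesis unfolding phased_def by simp
qed

lemma phased_translate:
  assumes "phased n c y"
  shows "phased n (c - m) (\<lambda>j. y (j + m))"
  unfolding phased_def
proof
  fix k
  show "if Q n dvd k - (c - m) then y (k + m) \<in> spacers n else y (k + m) = toep (k - (c - m))"
    using assms[unfolded phased_def, rule_format, of "k + m"] by (simp add: algebra_simps)
qed

text \<open>Holes of level \<open>n\<close> that are not holes of level \<open>Suc n\<close> carry
  values of \<open>toep\<close> at nonzero multiples of \<open>Q n\<close>, which are spacers of
  level at least \<open>n\<close>.\<close>

lemma phased_Suc: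
  assumes "phased (Suc n) c y"
  shows "phased n c y"
  unfolding phased_def
proof
  fix k
  consider "Q (Suc n) dvd k - c" | "\<not> Q (Suc n) dvd k - c" "Q n dvd k - c" | "\<not> Q n dvd k - c"
    by blast
  then show "if Q n dvd k - c then y k \<in> spacers n else y k = toep (k - c)"
  proof cases
    case 1
    then show ?thesis
      using phased_spacers[OF assms 1] spacers_antimono[of n "Suc n"] Q_dvd[of n "Suc n"]
        dvd_trans by auto
  next
    case 2
    then have "y k = toep (k - c)" "k - c \<noteq> 0" using phasedD[OF assms] by auto
    with 2 show ?thesis using toep_in_spacers by simp
  next
    case 3
    then show ?thesis
      using phasedD[OF assms] Q_dvd[of n "Suc n"] dvd_trans by (meson le_SucI order_refl)
  qed
qed

text \<open>A place where \<open>c\<close> fails to be a phase (junk if it is one). A single entry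
  refutes a phase, so the refutation passes to every code with the same entry there.\<close>

definition phase_defect :: "nat \<Rightarrow> int \<Rightarrow> (int \<Rightarrow> nat) \<Rightarrow> int" where
  "phase_defect n c y =
     (SOME k. \<not> (if Q n dvd k - c then y k \<in> spacers n else y k = toep (k - c)))"

lemma phase_defect:
  assumes "\<not> phased n c y" "y' (phase_defect n c y) = y (phase_defect n c y)"
  shows "\<not> phased n c y'"
proof -
  have "\<exists>k. \<not> (if Q n dvd k - c then y k \<in> spacers n else y k = toep (k - c))"
    using assms(1) unfolding phased_def by blast
  then have "\<not> (if Q n dvd phase_defect n c y - c then y (phase_defect n c y) \<in> spacers n
      else y (phase_defect n c y) = toep (phase_defect n c y - c))"
    unfolding phase_defect_def by (rule someI_ex)
  with assms(2) show ?thesis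
    unfolding phased_def by metis
qed

text \<open>Finitely many phases have to be refuted, and a long window refutes them all.\<close>

lemma phased_exists:
  assumes "y \<in> Y"
  obtains c where "0 \<le> c" "c < Q n" "phased n c y"
proof (rule ccontr)
  assume "\<not> thesis"
  with that have no: "\<not> phased n c y" if "c \<in> {0..<Q n}" for c using that by auto
  \<comment> \<open>Large enough to reach the defects of all \<open>Q n\<close> candidate
    phases.\<close>
  define L where "L = (\<Sum>c\<in>{0..<Q n}. \<bar>phase_defect n c y\<bar>)"
  obtain t where t: "t > L" "\<And>k. \<bar>k\<bar> \<le> L \<Longrightarrow> y k = toep (t + k)"
    using YE[OF assms] by metis
  \<comment> \<open>On the window, \<open>y\<close> is \<open>toep\<close> translated by
    \<open>t\<close>, whose holes are congruent to \<open>- t\<close>; hence this is the phase that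
    the window suggests.\<close>
  define c where "c = (- t) mod Q n"
  have c: "c \<in> {0..<Q n}" by (simp add: c_def)
  have ct: "Q n dvd t + c"
    unfolding c_def by (rule mod_0_imp_dvd) (simp add: mod_add_right_eq)
  define k where "k = phase_defect n c y"
  have "\<bar>k\<bar> \<le> L" unfolding L_def k_def using c by (intro member_le_sum) auto
  then have k: "y k = toep (t + k)" "t + k \<noteq> 0" using t by auto
  have eq: "t + k - (k - c) = t + c" "k - c - (t + k) = - (t + c)" by simp_all
  have "if Q n dvd k - c then y k \<in> spacers n else y k = toep (k - c)"
  proof (cases "Q n dvd k - c")
    case True
    then have "Q n dvd t + k" using ct eq by (metis diff_add_cancel dvd_add)
    with True k show ?thesis using toep_in_spacers by simp
  next
    case False
    then show ?thesis using toep_cong[of n "k - c" "t + k"] ct eq k by simp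
  qed
  moreover have "\<exists>k. \<not> (if Q n dvd k - c then y k \<in> spacers n else y k = toep (k - c))"
    using no[OF c] unfolding phased_def by blast
  then have "\<not> (if Q n dvd k - c then y k \<in> spacers n else y k = toep (k - c))"
    unfolding k_def phase_defect_def by (rule someI_ex)
  ultimately show False by blast
qed

end

locale aperiodic_ferenczi = ferenczi_parameters +
  assumes aper: "aperiodic_subshift (ferenczi q a)"
begin

text \<open>If two phases differ, each entry lies outside the holes of one of them, so the code is periodic.\<close>

lemma phased_unique:
  assumes "y \<in> Y" "phased n c y" "phased n c' y"
  shows "Q n dvd c' - c"
proof (rule ccontr)
  assume nd: "\<not> Q n dvd c' - c"
  have "y (k + Q n) = y k" for k
  proof -
    have "\<exists>d. phased n d y \<and> \<not> Q n dvd k - d"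
    proof (rule ccontr)
      assume "\<not> ?thesis"
      with assms have "Q n dvd k - c" "Q n dvd k - c'" by blast+
      then have "Q n dvd (k - c) - (k - c')" by (rule dvd_diff)
      with nd show False by simp
    qed
    then obtain d where d: "phased n d y" "\<not> Q n dvd k - d" by blast
    have eq: "k + Q n - d = (k - d) + Q n" by simp
    have "\<not> Q n dvd k + Q n - d" unfolding eq using d(2) by simp
    with d have "y (k + Q n) = toep (k + Q n - d)" "y k = toep (k - d)" by (simp_all add: phasedD)
    moreover have "toep (k + Q n - d) = toep (k - d)" using d(2) by (intro toep_cong) auto
    ultimately show ?thesis by simp
  qed
  then have "spell y = (\<lambda>i. spell y (i + psum y (Q n)))"
    using spell_translate[of y "Q n"] by (simp add: fun_eq_iff)
  moreover have p: "0 < psum y (Q n)" using psum_ge[of "Q n" y] Q_pos[of n] by linarith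
  ultimately have "(shift ^^ nat (psum y (Q n))) (spell y) = spell y"
    by (simp add: shift_funpow)
  moreover have "0 < nat (psum y (Q n))" using p by simp
  ultimately show False
    using aper spell_in_X[OF assms(1)] unfolding aperiodic_subshift_def by blast
qed

end

section \<open>Kakutani--Rokhlin partitions and coboundaries\<close>

lemma openin_cylinders:
  fixes X :: "(int \<Rightarrow> nat) set"
  shows "openin (top_of_set X) U \<longleftrightarrow>
    U \<subseteq> X \<and> (\<forall>x\<in>U. \<exists>L. \<forall>x'\<in>X. (\<forall>i. \<bar>i\<bar> \<le> L \<longrightarrow> x' i = x i) \<longrightarrow> x' \<in> U)"
    (is "_ \<longleftrightarrow> ?R")
proof
  assume "openin (top_of_set X) U"
  then obtain V where V: "open V" "U = X \<inter> V" by (auto simp: openin_open)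
  have "\<exists>L. \<forall>x'\<in>X. (\<forall>i. \<bar>i\<bar> \<le> L \<longrightarrow> x' i = x i) \<longrightarrow> x' \<in> U" if "x \<in> U" for x
  proof -
    have "openin (product_topology (\<lambda>i::int. euclidean :: nat topology) UNIV) V" "x \<in> V"
      using V that by (auto simp: open_fun_def)
    then obtain B where B: "x \<in> (\<Pi>\<^sub>E i\<in>UNIV. B i)" "finite {i. B i \<noteq> UNIV}" "(\<Pi>\<^sub>E i\<in>UNIV. B i) \<subseteq> V"
      by (auto dest!: product_topology_open_contains_basis)
    \<comment> \<open>If no coordinate is constrained, the \<open>Max\<close> of the empty set is
      arbitrary but the claim is void.\<close>
    then have L: "\<bar>i\<bar> \<le> Max (abs ` {i. B i \<noteq> UNIV})" if "B i \<noteq> UNIV" for i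
      using that by (intro Max_ge) auto
    have "x' \<in> V" if "\<forall>i. \<bar>i\<bar> \<le> Max (abs ` {i. B i \<noteq> UNIV}) \<longrightarrow> x' i = x i" for x'
    proof -
      have "x' i \<in> B i" for i using L[of i] that B(1) by (cases "B i = UNIV") (auto simp: PiE_iff)
      then show ?thesis using B(3) by auto
    qed
    with V(2) show ?thesis by blast
  qed
  then show ?R using V(2) by auto
next
  assume R: ?R
  then obtain L where L: "\<And>x x'. x \<in> U \<Longrightarrow> x' \<in> X \<Longrightarrow> (\<forall>i. \<bar>i\<bar> \<le> L x \<longrightarrow> x' i = x i) \<Longrightarrow> x' \<in> U"
    by metis
  define V where "V x = (\<Pi>\<^sub>E i\<in>UNIV. if \<bar>i\<bar> \<le> L x then {x i} else UNIV)" for x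
  have "open (V x)" for x
    unfolding V_def
  proof (rule open_PiE)
    have "{i. (if \<bar>i\<bar> \<le> L x then {x i} else UNIV) \<noteq> UNIV} \<subseteq> {- L x..L x}" by auto
    then show "finite {i. (if \<bar>i\<bar> \<le> L x then {x i} else UNIV) \<noteq> UNIV}"
      by (rule finite_subset) simp
  qed (auto intro: open_discrete)
  moreover have "x' \<in> V x \<longleftrightarrow> (\<forall>i. \<bar>i\<bar> \<le> L x \<longrightarrow> x' i = x i)" for x x'
    by (auto simp: V_def PiE_iff)
  then have "U = X \<inter> (\<Union>x\<in>U. V x)" using R L by auto
  moreover have "open (\<Union>x\<in>U. V x)" using calculation(1) by blast
  ultimately show "openin (top_of_set X) U" unfolding openin_open by blast
qed

lemma inj_shift: "inj shift"
proof (rule injI, rule ext)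
  fix x y :: "int \<Rightarrow> 'a" and i
  assume "shift x = shift y"
  then show "x i = y i" by (metis shift_def diff_add_cancel)
qed

section \<open>Atoms of partitions and of nested sequences\<close>

lemma ckr_Union: "ckr_partition X T P \<Longrightarrow> \<Union> (atoms T P) = X"
  by (simp add: ckr_partition_def)

lemma ckr_index_eqI:
  assumes "ckr_partition X T P" "p \<in> levels P" "p' \<in> levels P" "x \<in> atom T P p" "x \<in> atom T P p'"
  shows "p = p'"
proof -
  have "disjoint_family_on (atom T P) (levels P)" using assms(1) by (simp add: ckr_partition_def)
  then show ?thesis using assms(2-) by (auto simp: disjoint_family_on_def)
qed

lemma ckr_atom_eqI:
  assumes "ckr_partition X T P" "C \<in> atoms T P" "C' \<in> atoms T P" "x \<in> C" "x \<in> C'"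
  shows "C = C'"
proof -
  obtain p p' where p: "p \<in> levels P" "C = atom T P p" "p' \<in> levels P" "C' = atom T P p'"
    using assms(2,3) by (auto simp: atoms_def)
  then have "p = p'" using assms(4,5) by (intro ckr_index_eqI[OF assms(1)]) auto
  then show ?thesis using p by simp
qed

lemma ckr_atom_ex:
  assumes "ckr_partition X T P" "x \<in> X"
  obtains C where "C \<in> atoms T P" "x \<in> C"
  using ckr_Union[OF assms(1)] assms(2) by auto

lemma nested_ckr_atom_subset:
  assumes "nested_ckr X T P" "m \<le> n" "C \<in> atoms T (P n)"
  obtains C' where "C' \<in> atoms T (P m)" "C \<subseteq> C'"
proof -
  have "\<exists>C'\<in>atoms T (P m). C \<subseteq> C'"
    using assms(2,3)
  proof (induction n arbitrary: C rule: dec_induct)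
    case (step n)
    have "\<forall>C\<in>atoms T (P (Suc n)). \<exists>D\<in>atoms T (P n). C \<subseteq> D"
      using assms(1) by (simp add: nested_ckr_def)
    with step.prems obtain C1 where C1: "C1 \<in> atoms T (P n)" "C \<subseteq> C1" by blast
    from step.IH[OF C1(1)] C1(2) show ?case by (meson order_trans)
  qed blast
  with that show ?thesis by blast
qed

text \<open>The property \<open>small\<close> persists at later levels, so it survives finite
  intersections by passing to the larger level. A generating atom that contains \<open>x\<close> is
  the only such atom of its level.\<close>

lemma nested_ckr_small_atom:
  assumes P: "nested_ckr X T P" and U: "openin (top_of_set X) U" "x \<in> U"
  obtains n where "\<And>C. C \<in> atoms T (P n) \<Longrightarrow> x \<in> C \<Longrightarrow> C \<subseteq> U"
proof -
  have ckr: "ckr_partition X T (P n)" for n using P by (simp add: nested_ckr_def)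
  define small where "small U n \<longleftrightarrow> (\<forall>C\<in>atoms T (P n). x \<in> C \<longrightarrow> C \<subseteq> U)" for U n
  have mono: "small U n" if sm: "small U m" and mn: "m \<le> n" for U m n
    unfolding small_def
  proof safe
    fix C z assume C: "C \<in> atoms T (P n)" "x \<in> C" "z \<in> C"
    obtain C' where "C' \<in> atoms T (P m)" "C \<subseteq> C'"
      using nested_ckr_atom_subset[OF P mn C(1)] .
    with C sm show "z \<in> U" unfolding small_def by blast
  qed
  have "generate_topology_on (\<Union>n. atoms T (P n)) U"
    using P U(1) by (intro openin_topology_generated_by) (simp add: nested_ckr_def)
  then have "\<exists>n. small U n" using U(2)
  proof (induction U)
    case (Int U V)
    then obtain m n where "small U m" "small V n" by blast
    then have "small U (max m n)" "small V (max m n)" using mono by simp_all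
    then show ?case unfolding small_def by blast
  next
    case (UN S)
    then show ?case unfolding small_def by (meson UnionE Union_upper order_trans)
  next
    case (Basis C)
    then show ?case unfolding small_def using ckr_atom_eqI[OF ckr] by blast
  qed simp
  with that show ?thesis unfolding small_def by blast
qed

text \<open>By compactness finitely many atoms on which \<open>f\<close> is constant cover
  \<open>X\<close>; from the largest of their levels on, every atom lies in one of them.\<close>

lemma nested_ckr_locally_constant:
  assumes P: "nested_ckr X T P" and X: "compact X"
    and f: "\<And>x. x \<in> X \<Longrightarrow> \<exists>U. openin (top_of_set X) U \<and> x \<in> U \<and> (\<forall>x'\<in>U. f x' = f x)"
  shows "\<forall>\<^sub>F n in sequentially. \<forall>C\<in>atoms T (P n). \<forall>x\<in>C. \<forall>x'\<in>C. f x = f x'"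
proof -
  have ckr: "ckr_partition X T (P n)" for n using P by (simp add: nested_ckr_def)
  define \<C> where "\<C> = {C. (\<exists>n. C \<in> atoms T (P n)) \<and> (\<forall>x\<in>C. \<forall>x'\<in>C. f x = f x')}"
  have "openin (top_of_set X) C" if "C \<in> \<C>" for C
  proof -
    have "C \<in> (\<Union>n. atoms T (P n))" using that by (auto simp: \<C>_def)
    moreover have "topology_generated_by (\<Union>n. atoms T (P n)) = top_of_set X"
      using P by (simp add: nested_ckr_def)
    ultimately show ?thesis using topology_generated_by_Basis by metis
  qed
  moreover have "X \<subseteq> \<Union>\<C>"
  proof
    fix x assume x: "x \<in> X"
    obtain U where U: "openin (top_of_set X) U" "x \<in> U" "\<And>x'. x' \<in> U \<Longrightarrow> f x' = f x"
      using f[OF x] by blast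
    obtain n where n: "\<And>C. C \<in> atoms T (P n) \<Longrightarrow> x \<in> C \<Longrightarrow> C \<subseteq> U"
      using nested_ckr_small_atom[OF P U(1,2)] by blast
    obtain C where C: "C \<in> atoms T (P n)" "x \<in> C" using ckr_atom_ex[OF ckr x] .
    have fC: "f z = f x" if "z \<in> C" for z using n[OF C] U(3) that by blast
    have "\<exists>n. C \<in> atoms T (P n)" using C(1) by blast
    moreover have "\<forall>z\<in>C. \<forall>z'\<in>C. f z = f z'" using fC by simp
    ultimately have "C \<in> \<C>" unfolding \<C>_def by blast
    with C(2) show "x \<in> \<Union>\<C>" by blast
  qed
  ultimately obtain D where D: "D \<subseteq> \<C>" "finite D" "X \<subseteq> \<Union>D"
    using X unfolding compact_eq_openin_cover by meson
  then have "\<forall>C\<in>D. \<exists>n. C \<in> atoms T (P n)" unfolding \<C>_def by blast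
  then obtain \<nu> where \<nu>: "\<And>C. C \<in> D \<Longrightarrow> C \<in> atoms T (P (\<nu> C))" by metis
  have "f x = f x'" if n: "(\<Sum>C\<in>D. \<nu> C) \<le> n" and E: "E \<in> atoms T (P n)" "x \<in> E" "x' \<in> E" for n E x x'
  proof -
    have "x \<in> X" using E ckr_Union[OF ckr[of n]] by blast
    then obtain C where C: "C \<in> D" "x \<in> C" using D(3) by blast
    have "\<nu> C \<le> n" using member_le_sum[of C D \<nu>] C(1) D(2) n by simp
    then obtain C' where C': "C' \<in> atoms T (P (\<nu> C))" "E \<subseteq> C'"
      using nested_ckr_atom_subset[OF P _ E(1)] by blast
    have "C' = C" using C' C E(2) \<nu>[OF C(1)] by (intro ckr_atom_eqI[OF ckr]) auto
    then show ?thesis using C C' E D(1) unfolding \<C>_def by blast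
  qed
  then show ?thesis unfolding eventually_sequentially by blast
qed

text \<open>\<open>g\<close> starts at \<open>0\<close> on the base and adds up \<open>F\<close> on
  the way to the top. That \<open>F\<close> sums to zero along each tower brings it back to
  \<open>0\<close> on the return to a base.\<close>

lemma ckr_coboundary:
  fixes F :: "'x::topological_space \<Rightarrow> real"
  assumes P: "ckr_partition X T P" and T: "inj T" "T ` X \<subseteq> X"
    and const: "\<And>C x x'. C \<in> atoms T P \<Longrightarrow> x \<in> C \<Longrightarrow> x' \<in> C \<Longrightarrow> F x = F x'"
    and zero: "\<And>b z. b \<in> labels P \<Longrightarrow> z \<in> tower_base P b \<Longrightarrow> (\<Sum>k<height P b. F ((T ^^ k) z)) = 0"
  obtains g where "\<And>x. x \<in> X \<Longrightarrow> g (T x) = g x + F x"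
    and "\<And>C x x'. C \<in> atoms T P \<Longrightarrow> x \<in> C \<Longrightarrow> x' \<in> C \<Longrightarrow> g x = g x'"
proof -
  define z where "z b = (SOME z. z \<in> tower_base P b)" for b
  have z: "z b \<in> tower_base P b" if "b \<in> labels P" for b
    using P that some_in_eq[of "tower_base P b"] by (simp add: z_def ckr_partition_def)
  define lv where "lv x = (THE p. p \<in> levels P \<and> x \<in> atom T P p)" for x
  have lv: "lv x = p" if "p \<in> levels P" "x \<in> atom T P p" for x p
    unfolding lv_def using that ckr_index_eqI[OF P] by (intro the_equality) blast+
  \<comment> \<open>Summing along the reference points \<open>z b\<close>, rather than along the
    orbit through \<open>x\<close>, makes \<open>g\<close> constant on atoms by
    construction.\<close>
  define g where "g x = (\<Sum>j<snd (lv x). F ((T ^^ j) (z (fst (lv x)))))" for x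
  have inX: "x \<in> X" if "p \<in> levels P" "x \<in> atom T P p" for x p
    using ckr_Union[OF P] that by (auto simp: atoms_def)
  have ex: "\<exists>p\<in>levels P. x \<in> atom T P p" if "x \<in> X" for x
    using ckr_atom_ex[OF P that] by (auto simp: atoms_def)
  show ?thesis
  proof (rule that)
    fix x assume "x \<in> X"
    then obtain b k where p: "(b, k) \<in> levels P" "x \<in> atom T P (b, k)" using ex by fast
    then obtain y where y: "y \<in> tower_base P b" "x = (T ^^ k) y" by (auto simp: atom_def)
    have b: "b \<in> labels P" "k < height P b" using p(1) by (auto simp: levels_def)
    have "(T ^^ k) (z b) \<in> atom T P (b, k)" using z[OF b(1)] by (auto simp: atom_def)
    then have Fx: "F x = F ((T ^^ k) (z b))"
      using const p by (auto simp: atoms_def)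
    have gx: "g x = (\<Sum>j<k. F ((T ^^ j) (z b)))" using lv[OF p] by (simp add: g_def)
    show "g (T x) = g x + F x"
    proof (cases "Suc k < height P b")
      case True
      then have "(b, Suc k) \<in> levels P" "T x \<in> atom T P (b, Suc k)"
        using b y by (auto simp: levels_def atom_def intro!: image_eqI[of _ _ y])
      from lv[OF this] have "g (T x) = (\<Sum>j<Suc k. F ((T ^^ j) (z b)))" by (simp add: g_def)
      with gx Fx show ?thesis by simp
    next
      case False
      with b have k: "Suc k = height P b" by simp
      have "T x \<in> X" using T(2) \<open>x \<in> X\<close> by blast
      then obtain b' k' where p': "(b', k') \<in> levels P" "T x \<in> atom T P (b', k')" using ex by fast
      then obtain y' where y': "y' \<in> tower_base P b'" "T x = (T ^^ k') y'" by (auto simp: atom_def)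
      \<comment> \<open>The top of a tower is mapped into a base: otherwise injectivity puts
        \<open>x\<close> on the level below \<open>T x\<close>, which is not the top of its
        tower.\<close>
      have "k' = 0"
      proof (rule ccontr)
        assume "k' \<noteq> 0"
        then obtain l where l: "k' = Suc l" by (cases k') auto
        with y' T(1) have "x = (T ^^ l) y'" by (auto dest: injD)
        then have "(b', l) \<in> levels P" "x \<in> atom T P (b', l)"
          using p'(1) y' l by (auto simp: levels_def atom_def)
        from lv[OF this] lv[OF p] have "b' = b" "l = k" by auto
        with p'(1) l k show False by (auto simp: levels_def)
      qed
      then have "g (T x) = 0" using lv[OF p'] by (simp add: g_def)
      moreover have "g x + F x = 0" using zero[OF b(1) z[OF b(1)]] gx Fx k[symmetric] by simp
      ultimately show ?thesis by simp
    qed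
  next
    fix C x x' assume "C \<in> atoms T P" "x \<in> C" "x' \<in> C"
    then obtain p where "p \<in> levels P" "x \<in> atom T P p" "x' \<in> atom T P p"
      by (auto simp: atoms_def)
    then have "lv x = lv x'" using lv by metis
    then show "g x = g x'" by (simp add: g_def)
  qed
qed

text \<open>Gaussian elimination for a homogeneous system with fewer equations than
  unknowns.\<close>

lemma linear_dependence:
  fixes M :: "'b \<Rightarrow> 'a \<Rightarrow> real"
  assumes "finite B" "finite A" "card B < card A"
  obtains c where "\<exists>s\<in>A. c s \<noteq> 0" "\<And>b. b \<in> B \<Longrightarrow> (\<Sum>s\<in>A. c s * M b s) = 0"
proof -
  have "\<exists>c. (\<exists>s\<in>A. c s \<noteq> 0) \<and> (\<forall>b\<in>B. (\<Sum>s\<in>A. c s * M b s) = 0)"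
    using assms
  proof (induction B arbitrary: A M rule: finite_induct)
    case empty
    then show ?case by (intro exI[of _ "\<lambda>_. 1"]) (auto simp: card_gt_0_iff)
  next
    case (insert b B)
    show ?case
    proof (cases "\<forall>s\<in>A. M b s = 0")
      case True
      then show ?thesis using insert.IH[of A M] insert.hyps insert.prems by (auto simp: card_insert_if)
    next
      case False
      then obtain s0 where s0: "s0 \<in> A" "M b s0 \<noteq> 0" by blast
      \<comment> \<open>The equation of \<open>b\<close>, with pivot \<open>s0\<close>, is used to
        eliminate the unknown of \<open>s0\<close> from the others; \<open>c0\<close> below solves
        it for that unknown.\<close>
      define M' where "M' b' s = M b' s - M b' s0 * M b s / M b s0" for b' s
      have "card B < card (A - {s0})" using insert.hyps insert.prems s0 by simp
      then obtain c where c: "\<exists>s\<in>A - {s0}. c s \<noteq> 0"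
          "\<And>b'. b' \<in> B \<Longrightarrow> (\<Sum>s\<in>A - {s0}. c s * M' b' s) = 0"
        using insert.IH[of "A - {s0}" M'] insert.prems by auto
      define c0 where "c0 = - (\<Sum>s\<in>A - {s0}. c s * M b s) / M b s0"
      define c' where "c' = c(s0 := c0)"
      have split: "(\<Sum>s\<in>A. c' s * M b' s) = c0 * M b' s0 + (\<Sum>s\<in>A - {s0}. c s * M b' s)" for b'
        using insert.prems(1) s0(1) by (simp add: sum.remove c'_def)
      have "(\<Sum>s\<in>A. c' s * M b' s) = 0" if "b' \<in> insert b B" for b'
      proof (cases "b' = b")
        case True
        then show ?thesis using s0(2) by (simp add: split c0_def)
      next
        case False
        have "c0 * M b' s0 = - (\<Sum>s\<in>A - {s0}. c s * (M b' s0 * M b s / M b s0))"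
          by (simp add: c0_def sum_distrib_left sum_divide_distrib mult_ac)
        then have "(\<Sum>s\<in>A. c' s * M b' s) = (\<Sum>s\<in>A - {s0}. c s * M' b' s)"
          by (simp add: split M'_def right_diff_distrib sum_subtractf)
        with False that c(2) show ?thesis by simp
      qed
      moreover have "\<exists>s\<in>A. c' s \<noteq> 0" using c(1) by (auto simp: c'_def)
      ultimately show ?thesis by blast
    qed
  qed
  with that show ?thesis by blast
qed

context ferenczi_parameters
begin

section \<open>Topology of the subshift\<close>

lemma X_funpow: "x \<in> X \<Longrightarrow> (shift ^^ k) x \<in> X"
  unfolding shift_funpow by (rule X_translate)

lemma openin_funpow_image:
  assumes "openin (top_of_set X) B"
  shows "openin (top_of_set X) ((shift ^^ k) ` B)"
  unfolding openin_cylinders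
proof safe
  fix x assume x: "x \<in> B"
  then show "(shift ^^ k) x \<in> X" using assms X_funpow openin_imp_subset by blast
  obtain L where L: "\<And>x'. x' \<in> X \<Longrightarrow> (\<And>i. \<bar>i\<bar> \<le> L \<Longrightarrow> x' i = x i) \<Longrightarrow> x' \<in> B"
    using assms x unfolding openin_cylinders by meson
  show "\<exists>L. \<forall>x'\<in>X. (\<forall>i. \<bar>i\<bar> \<le> L \<longrightarrow> x' i = (shift ^^ k) x i) \<longrightarrow> x' \<in> (shift ^^ k) ` B"
  proof (intro exI[of _ "L + int k"] ballI impI)
    fix x' assume x': "x' \<in> X" "\<forall>i. \<bar>i\<bar> \<le> L + int k \<longrightarrow> x' i = (shift ^^ k) x i"
    have "x' (i - int k) = x i" if "\<bar>i\<bar> \<le> L" for i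
      using x'(2)[rule_format, of "i - int k"] that by (auto simp: shift_funpow)
    then have "(\<lambda>i. x' (i + - int k)) \<in> B" using X_translate[OF x'(1), of "- int k"] by (intro L) auto
    then show "x' \<in> (shift ^^ k) ` B"
      by (rule image_eqI[rotated]) (simp add: shift_funpow)
  qed
qed

lemma openin_atom:
  assumes "ckr_partition X shift P" "C \<in> atoms shift P"
  shows "openin (top_of_set X) C"
  using assms openin_funpow_image
  by (auto simp: ckr_partition_def atoms_def atom_def levels_def)

lemma compact_X: "compact X"
proof -
  have "openin (top_of_set UNIV) (- X)"
    unfolding openin_cylinders
  proof safe
    fix x assume "x \<notin> X"
    then obtain L where L: "\<not> (\<exists>t\<ge>int L. \<forall>i. \<bar>i\<bar> \<le> int L \<longrightarrow> x i = spell toep (t + i))"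
      unfolding ferenczi_iff by blast
    show "\<exists>L. \<forall>x'\<in>UNIV. (\<forall>i. \<bar>i\<bar> \<le> L \<longrightarrow> x' i = x i) \<longrightarrow> x' \<in> - X"
    proof (intro exI[of _ "int L"] ballI impI)
      fix x' assume x': "\<forall>i. \<bar>i\<bar> \<le> int L \<longrightarrow> x' i = x i"
      show "x' \<in> - X"
      proof
        assume "x' \<in> X"
        then obtain t where "t \<ge> int L" "\<And>i. \<bar>i\<bar> \<le> int L \<Longrightarrow> x' i = spell toep (t + i)"
          unfolding ferenczi_iff by blast
        with L x' show False by metis
      qed
    qed
  qed simp
  then have "closed X" by (simp add: closed_def)
  moreover have "compactin (product_topology (\<lambda>i::int. euclidean :: nat topology) UNIV) (\<Pi>\<^sub>E i\<in>UNIV. {0, 1})"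
    by (subst compactin_PiE) (auto intro: finite_imp_compactin)
  then have "compact (\<Pi>\<^sub>E i\<in>(UNIV :: int set). {0, 1 :: nat})"
    by (simp add: euclidean_product_topology)
  moreover have "X \<subseteq> (\<Pi>\<^sub>E i\<in>UNIV. {0, 1})" by (auto simp: ferenczi_def)
  ultimately show ?thesis using compact_Int_closed by (metis Int_absorb1 inf_commute)
qed

end

section \<open>Towers over the generating words\<close>

context aperiodic_ferenczi
begin

text \<open>These code the base of level \<open>n\<close>: a copy of \<open>gen_word q a n\<close>
  begins at zero number \<open>- hole n\<close>, and the spacer after it, at index
  \<open>Q n - hole n\<close>, is the label of the tower.\<close>

definition D :: "nat \<Rightarrow> (int \<Rightarrow> nat) set" where
  "D n = {y \<in> Y. phased n (- hole n) y}"

text \<open>The code with \<open>s\<close> in every hole. By \<open>D_fill\<close>, a code in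
  \<open>D n\<close> with label \<open>s\<close> agrees with it over two blocks, in which
  \<open>Q n - hole n\<close> is the only hole.\<close>

definition fill :: "nat \<Rightarrow> nat \<Rightarrow> int \<Rightarrow> nat" where
  "fill n s j = (if Q n dvd j + hole n then s else toep (j + hole n))"

text \<open>The tower of \<open>s\<close> runs through an occurrence of \<open>gen_word q a n\<close> followed by \<open>s\<close> ones, but the
  base is cut inside the word: translating the holes by \<^const>\<open>hole\<close>, whose distance to both ends of a
  block tends to infinity, makes the bases shrink to one point.\<close>

definition tower :: "nat \<Rightarrow> (int \<Rightarrow> nat) towers" where
  "tower n = \<lparr>labels = spacers n, height = \<lambda>s. nat (psum (fill n s) (Q n)),
     tower_base = \<lambda>s. spell ` {y \<in> D n. y (Q n - hole n) = s}\<rparr>"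

lemma hole_nonneg: "0 \<le> hole n"
  using hole_ge[of n] by linarith

lemma D_Y: "y \<in> D n \<Longrightarrow> y \<in> Y"
  by (simp add: D_def)

lemma D_phased: "y \<in> D n \<Longrightarrow> phased n (- hole n) y"
  by (simp add: D_def)

lemma D_translate:
  assumes "y \<in> D n" "Q n dvd m"
  shows "(\<lambda>j. y (j + m)) \<in> D n"
  using Y_translate[OF D_Y[OF assms(1)], of m]
    phased_cong[OF phased_translate[OF D_phased[OF assms(1)], of m], of "- hole n"] assms(2)
  by (simp add: D_def)

lemma D_Suc: "y \<in> D (Suc n) \<Longrightarrow> y \<in> D n"
  using phased_cong[OF phased_Suc, of n "- hole (Suc n)" y "- hole n"]
  by (simp add: D_def hole_Suc)

lemma D_label:
  assumes "y \<in> D n"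
  shows "y (Q n - hole n) \<in> spacers n"
  using phased_spacers[OF D_phased[OF assms]] by simp

lemma D_fill:
  assumes "y \<in> D n" "- hole n < j" "j < 2 * Q n - hole n"
  shows "y j = fill n (y (Q n - hole n)) j"
proof (cases "Q n dvd j + hole n")
  case True
  then obtain m where m: "j + hole n = Q n * m" ..
  have "0 < m" using assms(2) m Q_pos[of n] zero_less_mult_pos[of "Q n" m] by simp
  moreover have "Q n * m < Q n * 2" using assms(3) m by linarith
  then have "m < 2" unfolding mult_less_cancel_left_pos[OF Q_pos] .
  ultimately have "m = 1" by simp
  with m have "j = Q n - hole n" by simp
  then show ?thesis by (simp add: fill_def)
next
  case False
  then show ?thesis using phasedD[OF D_phased[OF assms(1)], of j] by (simp add: fill_def)
qed

lemma D_psum: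
  assumes "y \<in> D n" "0 \<le> k" "k \<le> Q n"
  shows "psum y k = psum (fill n (y (Q n - hole n))) k"
proof (rule psum_cong[of 0 "Q n"])
  fix j assume "0 < j" "j \<le> Q n"
  then show "y j = fill n (y (Q n - hole n)) j"
    using hole_nonneg[of n] hole_le[of n] by (intro D_fill[OF assms(1)]) linarith+
qed (use assms(2,3) in auto)

lemma D_height:
  assumes "y \<in> D n"
  shows "int (height (tower n) (y (Q n - hole n))) = psum y (Q n)"
  using D_psum[OF assms, of "Q n"] psum_ge[of "Q n" y] Q_pos[of n]
  by (simp add: tower_def del: Q_pos)

text \<open>No hole lies strictly between \<open>- hole n\<close> and \<open>Q n - hole n\<close>,
  so all codes in \<open>D n\<close> agree there. This makes the bases shrink to a point.\<close>

lemma D_window: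
  assumes "y \<in> D n" "y' \<in> D n" "\<bar>i\<bar> \<le> int n"
  shows "spell y i = spell y' i"
proof (rule spell_cong[of "- hole n" "Q n - hole n - 1"])
  fix j assume j: "- hole n < j" "j \<le> Q n - hole n - 1"
  then have "\<not> Q n dvd j + hole n" using zdvd_imp_le[of "Q n" "j + hole n"] by auto
  then show "y j = y' j"
    using phasedD[OF D_phased[OF assms(1)], of j] phasedD[OF D_phased[OF assms(2)], of j] by simp
next
  show "- hole n \<le> 0" "0 \<le> Q n - hole n - 1" using hole_nonneg[of n] hole_le[of n] by linarith+
  then show "psum y (- hole n) \<le> i" "i \<le> psum y (Q n - hole n - 1)"
    using psum_le[of "- hole n" y] psum_ge[of "Q n - hole n - 1" y] assms(3) hole_ge[of n] hole_le[of n]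
    by linarith+
qed

lemma D_decomposition:
  assumes "x \<in> X"
  obtains y k where "y \<in> D n" "int k < psum y (Q n)" "x = (shift ^^ k) (spell y)"
proof -
  obtain y i where y: "y \<in> Y" "x = (\<lambda>j. spell y (j + i))" using X_translated_spell[OF assms] .
  obtain c where c: "phased n c y" using phased_exists[OF y(1)] .
  obtain l where l: "psum y l \<le> i" "i < psum y (l + 1)" by (rule psum_sandwich)
  \<comment> \<open>The last index up to \<open>l\<close> in the class of \<open>c + hole n\<close>:
    translating by it turns phase \<open>c\<close> into \<open>- hole n\<close>.\<close>
  define m where "m = l - (l - (c + hole n)) mod Q n"
  have m: "m \<le> l" "l + 1 \<le> m + Q n"
    using pos_mod_sign[OF Q_pos[of n], of "l - (c + hole n)"]
      pos_mod_bound[OF Q_pos[of n], of "l - (c + hole n)"]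
    unfolding m_def by linarith+
  have "m - (c + hole n) = (l - (c + hole n)) - (l - (c + hole n)) mod Q n" by (simp add: m_def)
  then have dvd: "Q n dvd m - (c + hole n)" by (simp add: minus_mod_eq_mult_div)
  define y' where "y' = (\<lambda>j. y (j + m))"
  have "phased n (- hole n) y'"
    unfolding y'_def using dvd
    by (intro phased_cong[OF phased_translate[OF c]]) (simp add: algebra_simps)
  then have "y' \<in> D n" using Y_translate[OF y(1)] by (simp add: D_def y'_def)
  moreover have "psum y m \<le> i" "i < psum y (m + Q n)"
    using l m by (auto intro: order_trans[OF _ l(1)] less_le_trans[OF l(2)])
  then have "int (nat (i - psum y m)) < psum y' (Q n)" "x = (shift ^^ nat (i - psum y m)) (spell y')"
    using psum_translate[of y m "Q n"]
    by (simp_all add: y'_def y(2) shift_funpow spell_translate add.commute[of m])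
  ultimately show ?thesis by (rule that)
qed

text \<open>The codes of two representations are translates of each other by some \<open>j\<close>
  with \<open>0 \<le> j < Q n\<close>. Both have phase \<open>- hole n\<close>, so
  \<open>phased_unique\<close>, and with it aperiodicity, gives \<open>j = 0\<close>.\<close>

lemma D_unique_aux:
  assumes y: "y \<in> D n" "y' \<in> D n" and k: "k \<le> k'" "int k' < psum y' (Q n)"
    and eq: "(shift ^^ k) (spell y) = (shift ^^ k') (spell y')"
  shows "k = k' \<and> y = y'"
proof -
  have s: "spell y i = spell y' (i + (int k' - int k))" for i
    using fun_cong[OF eq, of "i - int k"] by (simp add: shift_funpow algebra_simps)
  from s[of 0] obtain j where j: "int k' - int k = psum y' j" by (auto simp: spell_eq_0_iff)
  have "spell y = spell (\<lambda>i. y' (i + j))" using s j by (simp add: spell_translate fun_eq_iff)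
  then have yj: "y = (\<lambda>i. y' (i + j))" using inj_spell by (simp add: inj_eq)
  have "psum y' 0 \<le> psum y' j" "psum y' j < psum y' (Q n)" using j k by (simp, linarith)
  then have "0 \<le> j" "j < Q n" by (simp_all del: psum_0)
  have "phased n (- hole n - j) y" unfolding yj by (rule phased_translate[OF D_phased[OF y(2)]])
  from phased_unique[OF D_Y[OF y(1)] D_phased[OF y(1)] this] have "Q n dvd j" by simp
  with \<open>0 \<le> j\<close> \<open>j < Q n\<close> have "j = 0" using zdvd_imp_le[of "Q n" j] by linarith
  then show ?thesis using j yj by simp
qed

lemma D_unique:
  assumes "y \<in> D n" "y' \<in> D n" and "int k < psum y (Q n)" "int k' < psum y' (Q n)"
    and "(shift ^^ k) (spell y) = (shift ^^ k') (spell y')"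
  shows "k = k'" "y = y'"
proof -
  have "k = k' \<and> y = y'"
  proof (cases "k \<le> k'")
    case True
    from D_unique_aux[OF assms(1,2) True assms(4,5)] show ?thesis .
  next
    case False
    then have "k' \<le> k" by simp
    from D_unique_aux[OF assms(2,1) this assms(3) assms(5)[symmetric]] show ?thesis by simp
  qed
  then show "k = k'" "y = y'" by simp_all
qed

text \<open>The code of the single point in all bases. By \<open>star_eq\<close>, the value
  \<open>toep (k + hole n)\<close> is the same for all \<open>n > \<bar>k\<bar>\<close>.\<close>

definition star :: "int \<Rightarrow> nat" where
  "star k = toep (k + hole (nat \<bar>k\<bar> + 1))"

lemma star_eq:
  assumes "\<bar>k\<bar> < int n"
  shows "star k = toep (k + hole n)"
proof -
  have "nat \<bar>k\<bar> + 1 \<le> n" using assms by linarith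
  then show ?thesis
  proof (induction n rule: dec_induct)
    case (step n)
    then have "0 < k + hole n" "k + hole n < Q n"
      using hole_ge[of n] hole_le[of n] by linarith+
    then have "\<not> Q n dvd k + hole n" using zdvd_imp_le[of "Q n" "k + hole n"] by auto
    then have "toep (k + hole (Suc n)) = toep (k + hole n)"
      by (rule toep_cong) (simp add: hole_Suc)
    with step show ?case by simp
  qed (simp add: star_def)
qed

lemma star_D: "star \<in> D n"
proof -
  have "star \<in> Y"
    unfolding Y_def
  proof safe
    fix L :: nat
    show "\<exists>t>int L. \<forall>k. \<bar>k\<bar> \<le> int L \<longrightarrow> star k = toep (t + k)"
      using hole_ge[of "Suc L"] star_eq[of _ "Suc L"]
      by (intro exI[of _ "hole (Suc L)"]) (auto simp: add.commute)
  qed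
  moreover have "phased n (- hole n) star"
    unfolding phased_def
  proof
    fix k
    \<comment> \<open>Beyond both \<open>n\<close> and \<open>\<bar>k\<bar>\<close>: then
      \<open>k + hole N\<close> is positive and congruent to \<open>k + hole n\<close> modulo
      \<open>Q n\<close>.\<close>
    define N where "N = max n (nat \<bar>k\<bar> + 1)"
    have k: "star k = toep (k + hole N)" by (rule star_eq) (simp add: N_def)
    have dvd: "Q n dvd hole N - hole n" by (rule hole_cong) (simp add: N_def)
    have pos: "0 < k + hole N" using hole_ge[of N] by (simp add: N_def)
    show "if Q n dvd k - - hole n then star k \<in> spacers n else star k = toep (k - - hole n)"
    proof (cases "Q n dvd k + hole n")
      case True
      then have "Q n dvd (k + hole n) + (hole N - hole n)" using dvd by (rule dvd_add)
      with True pos show ?thesis using toep_in_spacers[of n "k + hole N"] by (simp add: k)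
    next
      case False
      then show ?thesis using toep_cong[OF False, of "k + hole N"] dvd by (simp add: k)
    qed
  qed
  ultimately show ?thesis by (simp add: D_def)
qed

text \<open>Each spacer of level \<open>N \<ge> n\<close> occurs in \<open>star\<close> in a hole of
  level \<open>n\<close>; translating \<open>star\<close> brings it to the index of the
  label.\<close>

lemma D_label_ex:
  assumes "s \<in> spacers n"
  obtains y where "y \<in> D n" "y (Q n - hole n) = s"
proof -
  obtain N i where N: "n \<le> N" "i < q N" "s = a N i" using assms by (rule spacersE)
  \<comment> \<open>Relative to the phase of level \<open>Suc N\<close>, index \<open>k\<close> is
    \<open>Q N * (int i + 1)\<close>, where \<open>toep\<close> takes the value
    \<open>a N i\<close>.\<close>
  define k where "k = Q N * (int i + 1) - hole (Suc N)"
  have "\<not> Q (Suc N) dvd Q N * (int i + 1)"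
    using N(2) less_imp_neq[OF Q_pos[of N]] unfolding Q_Suc by (auto dest: zdvd_imp_le)
  then have "star k = toep (Q N * (int i + 1))"
    using phasedD[OF D_phased[OF star_D[of "Suc N"]], of k] by (simp add: k_def)
  then have sk: "star k = s" using toep_mult[OF N(2)] N(3) by simp
  have "Q n dvd Q N * (int i + 1) - (hole (Suc N) - hole n) - Q n"
    using N(1) by (intro dvd_diff dvd_mult2 Q_dvd hole_cong) simp_all
  then have "Q n dvd k - (Q n - hole n)" by (simp add: k_def algebra_simps)
  from D_translate[OF star_D this] show ?thesis by (rule that) (simp add: sk)
qed

section \<open>The towers form a clopen partition\<close>

lemma tower_baseE:
  assumes "z \<in> tower_base (tower n) s"
  obtains y where "y \<in> D n" "y (Q n - hole n) = s" "z = spell y"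
  using assms by (auto simp: tower_def)

lemma tower_baseI: "y \<in> D n \<Longrightarrow> y (Q n - hole n) = s \<Longrightarrow> spell y \<in> tower_base (tower n) s"
  by (auto simp: tower_def)

lemma labels_tower [simp]: "labels (tower n) = spacers n"
  by (simp add: tower_def)

lemma D_atom:
  assumes "y \<in> D n" "int k < psum y (Q n)"
  shows "(y (Q n - hole n), k) \<in> levels (tower n)"
    and "(shift ^^ k) (spell y) \<in> atom shift (tower n) (y (Q n - hole n), k)"
  using D_label[OF assms(1)] D_height[OF assms(1)] assms(2) tower_baseI[OF assms(1) refl]
  by (auto simp: levels_def atom_def)

lemma tower_atomE:
  assumes "p \<in> levels (tower n)" "x \<in> atom shift (tower n) p"
  obtains y k where "y \<in> D n" "p = (y (Q n - hole n), k)" "int k < psum y (Q n)"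
    "x = (shift ^^ k) (spell y)"
proof -
  obtain s k where p: "p = (s, k)" by fastforce
  obtain y where "y \<in> D n" "y (Q n - hole n) = s" "x = (shift ^^ k) (spell y)"
    using assms(2) unfolding p atom_def by (auto elim!: tower_baseE)
  moreover from this D_height[of y n] assms(1) have "int k < psum y (Q n)"
    by (simp add: p levels_def)
  ultimately show ?thesis using that p by blast
qed

text \<open>A nearby point has some phase at level \<open>n\<close>. A long window refutes every
  wrong phase, so that phase is the one of the base; the label is visible as well.\<close>

lemma openin_tower_base: "openin (top_of_set X) (tower_base (tower n) s)"
  unfolding openin_cylinders
proof safe
  fix z assume "z \<in> tower_base (tower n) s"
  then obtain y where y: "y \<in> D n" "y (Q n - hole n) = s" "z = spell y" by (rule tower_baseE)
  note yY = D_Y[OF y(1)]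
  show "z \<in> X" using y yY by (simp add: spell_in_X)
  \<comment> \<open>Reaches the label and the defects of all candidate phases; the value of
    \<open>phase_defect\<close> at the true phase is junk and does no harm.\<close>
  define L where "L = Q n + (\<Sum>c\<in>{0..<Q n}. \<bar>phase_defect n c y\<bar>)"
  have "(\<Sum>c\<in>{0..<Q n}. \<bar>phase_defect n c y\<bar>) \<ge> 0" by (rule sum_nonneg) simp
  then have L: "Q n \<le> L" "0 \<le> L" using Q_pos[of n] unfolding L_def by linarith+
  show "\<exists>L. \<forall>x'\<in>X. (\<forall>i. \<bar>i\<bar> \<le> L \<longrightarrow> x' i = z i) \<longrightarrow> x' \<in> tower_base (tower n) s"
  proof (intro exI[of _ "(int K + 1) * (L + 1)"] ballI impI)
    fix x' assume x': "x' \<in> X" "\<forall>i. \<bar>i\<bar> \<le> (int K + 1) * (L + 1) \<longrightarrow> x' i = z i"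
    have "x' 0 = 0" using x'(2)[rule_format, of 0] L y(3) by simp
    then obtain y' where y': "y' \<in> Y" "x' = spell y'" using X_spell[OF x'(1)] by blast
    have eq: "y k = y' k" if "\<bar>k\<bar> \<le> L" for k
      using spell_determines[of y K L y' k] that x'(2) y'(2) y(3) Y_le[OF yY] L by auto
    obtain c where c: "0 \<le> c" "c < Q n" "phased n c y'" using phased_exists[OF y'(1)] .
    have "\<bar>phase_defect n c y\<bar> \<le> (\<Sum>c\<in>{0..<Q n}. \<bar>phase_defect n c y\<bar>)"
      using c by (intro member_le_sum) auto
    then have "\<bar>phase_defect n c y\<bar> \<le> L" using Q_pos[of n] unfolding L_def by linarith
    then have "phased n c y" using phase_defect[of n c y y'] eq c(3) by metis
    then have "Q n dvd - hole n - c" using phased_unique[OF yY _ D_phased[OF y(1)]] by blast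
    then have "y' \<in> D n" using phased_cong[OF c(3)] y'(1) by (simp add: D_def)
    moreover have "y' (Q n - hole n) = s"
      using eq[of "Q n - hole n"] y(2) L hole_nonneg[of n] hole_le[of n] by simp
    ultimately show "x' \<in> tower_base (tower n) s" unfolding y'(2) by (rule tower_baseI)
  qed
qed

lemma disjoint_tower: "disjoint_family_on (atom shift (tower n)) (levels (tower n))"
  unfolding disjoint_family_on_def
proof (intro ballI impI equals0I)
  fix p p' x
  assume p: "p \<in> levels (tower n)" "p' \<in> levels (tower n)" "p \<noteq> p'"
    and x: "x \<in> atom shift (tower n) p \<inter> atom shift (tower n) p'"
  obtain y k where y: "y \<in> D n" "p = (y (Q n - hole n), k)" "int k < psum y (Q n)"
      "x = (shift ^^ k) (spell y)"
    using tower_atomE[OF p(1)] x by blast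
  obtain y' k' where y': "y' \<in> D n" "p' = (y' (Q n - hole n), k')" "int k' < psum y' (Q n)"
      "x = (shift ^^ k') (spell y')"
    using tower_atomE[OF p(2)] x by blast
  have "k = k'" "y = y'" using D_unique[OF y(1) y'(1) y(3) y'(3)] y(4) y'(4) by auto
  with y y' p(3) show False by simp
qed

lemma Union_tower: "\<Union> (atoms shift (tower n)) = X"
proof
  show "\<Union> (atoms shift (tower n)) \<subseteq> X"
    by (auto simp: atoms_def elim!: tower_atomE intro!: X_funpow spell_in_X dest: D_Y)
  show "X \<subseteq> \<Union> (atoms shift (tower n))"
  proof
    fix x assume "x \<in> X"
    then obtain y k where "y \<in> D n" "int k < psum y (Q n)" "x = (shift ^^ k) (spell y)"
      by (rule D_decomposition)
    with D_atom[of y n k] show "x \<in> \<Union> (atoms shift (tower n))" by (auto simp: atoms_def)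
  qed
qed

lemma closedin_tower_base:
  assumes s: "s \<in> spacers n"
  shows "closedin (top_of_set X) (tower_base (tower n) s)"
proof -
  obtain y0 where y0: "y0 \<in> D n" "y0 (Q n - hole n) = s" using D_label_ex[OF s] .
  have "0 < psum y0 (Q n)" using psum_ge[of "Q n" y0] Q_pos[of n] by linarith
  then have 0: "(s, 0) \<in> levels (tower n)" using D_atom(1)[OF y0(1), of 0] y0(2) by simp
  have at0: "atom shift (tower n) (s, 0) = tower_base (tower n) s" by (simp add: atom_def)
  define V where "V = (\<Union>p\<in>levels (tower n) - {(s, 0)}. atom shift (tower n) p)"
  have "openin (top_of_set X) V"
    unfolding V_def atom_def
    by (intro openin_Union) (auto intro!: openin_funpow_image openin_tower_base)
  moreover have "X - tower_base (tower n) s = V"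
  proof -
    have "X = atom shift (tower n) (s, 0) \<union> V"
      using Union_tower[of n] 0 unfolding atoms_def V_def by blast
    moreover have "atom shift (tower n) p \<inter> tower_base (tower n) s = {}"
      if "p \<in> levels (tower n)" "p \<noteq> (s, 0)" for p
      using disjoint_tower[of n] that 0 unfolding disjoint_family_on_def at0[symmetric] by blast
    then have "V \<inter> tower_base (tower n) s = {}" unfolding V_def by blast
    ultimately show ?thesis unfolding at0 by blast
  qed
  moreover have "tower_base (tower n) s \<subseteq> X"
    using openin_imp_subset[OF openin_tower_base] .
  ultimately show ?thesis by (simp add: closedin_def)
qed

lemma ckr_tower: "ckr_partition X shift (tower n)"
  unfolding ckr_partition_def
proof (intro conjI ballI)
  show "labels (tower n) \<noteq> {}" by (simp add: spacers_nonempty)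
  fix s assume "s \<in> labels (tower n)"
  then have s: "s \<in> spacers n" by simp
  obtain y where y: "y \<in> D n" "y (Q n - hole n) = s" using D_label_ex[OF s] .
  show "0 < height (tower n) s"
    using D_height[OF y(1)] y(2) psum_ge[of "Q n" y] Q_pos[of n] by (metis less_le_trans of_nat_0_less_iff less_imp_le)
  show "tower_base (tower n) s \<noteq> {}" using tower_baseI[OF y] by blast
qed (use openin_tower_base closedin_tower_base disjoint_tower Union_tower in auto)

section \<open>Nestedness of the towers\<close>

lemma base_tower: "base (tower n) = spell ` D n"
proof safe
  fix x assume "x \<in> base (tower n)"
  then show "x \<in> spell ` D n" by (auto simp: base_def elim!: tower_baseE)
next
  fix y assume y: "y \<in> D n"
  with D_label[OF y] tower_baseI[OF y refl] show "spell y \<in> base (tower n)"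
    unfolding base_def labels_tower by blast
qed

lemma nested_tower: "nested_ckr X shift tower"
  unfolding nested_ckr_def
proof (intro conjI allI ballI)
  show "ckr_partition X shift (tower n)" for n by (rule ckr_tower)
  show "base (tower (Suc n)) \<subseteq> base (tower n)" for n
    by (auto simp: base_tower dest: D_Suc)
  show "\<exists>x. (\<Inter>n. base (tower n)) = {x}"
  proof (intro exI equalityI subsetI)
    fix x assume x: "x \<in> (\<Inter>n. base (tower n))"
    have "x i = spell star i" for i
    proof -
      obtain y where "y \<in> D (nat \<bar>i\<bar>)" "x = spell y" using x by (auto simp: base_tower)
      then show ?thesis using D_window[OF _ star_D, of y "nat \<bar>i\<bar>" i] by simp
    qed
    then show "x \<in> {spell star}" by auto
  qed (auto simp: base_tower star_D)
  show "\<exists>C'\<in>atoms shift (tower n). C \<subseteq> C'" if C: "C \<in> atoms shift (tower (Suc n))" for n C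
  proof -
    obtain s k where p: "(s, k) \<in> levels (tower (Suc n))" "C = atom shift (tower (Suc n)) (s, k)"
      using C unfolding atoms_def by fast
    then have "s \<in> spacers (Suc n)" by (simp add: levels_def)
    then obtain y0 where y0: "y0 \<in> D (Suc n)" "y0 (Q (Suc n) - hole (Suc n)) = s"
      by (rule D_label_ex)
    \<comment> \<open>The positions of zeros up to the top of a tower depend on its label only, so
      the sample \<open>y0\<close> locates height \<open>k\<close> for all its points: between zeros
      \<open>l\<close> and \<open>l + 1\<close>.\<close>
    obtain l where l: "psum y0 l \<le> int k" "int k < psum y0 (l + 1)" by (rule psum_sandwich)
    have "int k < psum y0 (Q (Suc n))" using D_height[OF y0(1)] y0(2) p(1) by (simp add: levels_def)
    then have lQ: "l < Q (Suc n)" using l(1) by (metis le_less_trans psum_less_iff)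
    have "psum y0 0 < psum y0 (l + 1)" using l(2) by simp
    then have l0: "0 \<le> l" unfolding psum_less_iff by simp
    \<comment> \<open>Zero number \<open>m\<close> starts the passage through a tower of level
      \<open>n\<close> that contains height \<open>k\<close>.\<close>
    define m where "m = l - l mod Q n"
    have m: "0 \<le> m" "m \<le> l" "l + 1 \<le> m + Q n" "Q n dvd m"
      using pos_mod_sign[OF Q_pos[of n], of l] pos_mod_bound[OF Q_pos[of n], of l]
        zmod_le_nonneg_dividend[OF l0, of "Q n"]
      unfolding m_def by (linarith, linarith, linarith, simp add: minus_mod_eq_mult_div)
    have mQ: "m + Q n \<le> Q (Suc n)"
    proof -
      obtain j where j: "m = Q n * j" using m(4) ..
      have "Q n * j < Q n * (int (q n) + 1)" using j m(2) lQ Q_Suc[of n] by linarith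
      then have "j < int (q n) + 1" unfolding mult_less_cancel_left_pos[OF Q_pos] .
      then have "j + 1 \<le> int (q n) + 1" by linarith
      then have "Q n * (j + 1) \<le> Q n * (int (q n) + 1)" by (rule mult_left_mono) (simp add: less_imp_le)
      then show ?thesis by (simp add: j Q_Suc algebra_simps)
    qed
    \<comment> \<open>The label of that tower and the height in it depend on \<open>s\<close> and
      \<open>k\<close> only.\<close>
    define s' where "s' = fill (Suc n) s (m + (Q n - hole n))"
    define k' where "k' = k - nat (psum y0 m)"
    have "psum y0 0 \<le> psum y0 m" unfolding psum_le_iff by (rule m(1))
    then have pm: "0 \<le> psum y0 m" by simp
    have "psum y0 m \<le> psum y0 l" unfolding psum_le_iff by (rule m(2))
    then have k': "int k = psum y0 m + int k'" using l(1) pm unfolding k'_def by linarith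
    have "psum y0 (l + 1) \<le> psum y0 (m + Q n)" unfolding psum_le_iff by (rule m(3))
    then have k_less: "int k < psum y0 (m + Q n)" using l(2) by linarith
    have "(s', k') \<in> levels (tower n) \<and> (shift ^^ k) (spell y) \<in> atom shift (tower n) (s', k')"
      if y: "y \<in> D (Suc n)" "y (Q (Suc n) - hole (Suc n)) = s" for y
    proof -
      have ps: "psum y j = psum y0 j" if "0 \<le> j" "j \<le> Q (Suc n)" for j
        using D_psum[OF y(1) that] D_psum[OF y0(1) that] y(2) y0(2) by simp
      define y' where "y' = (\<lambda>j. y (j + m))"
      have y': "y' \<in> D n" unfolding y'_def by (rule D_translate[OF D_Suc[OF y(1)] m(4)])
      have "y (m + (Q n - hole n)) = s'"
        unfolding s'_def y(2)[symmetric]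
        using m(1) mQ hole_nonneg[of n] hole_le[of n] hole_nonneg[of "Suc n"] hole_le[of "Suc n"]
        by (intro D_fill[OF y(1)]) linarith+
      then have s': "y' (Q n - hole n) = s'" by (simp add: y'_def add.commute)
      have "psum y' (Q n) = psum y0 (m + Q n) - psum y0 m"
        using psum_translate[of y m "Q n"] ps[of m] ps[of "m + Q n"] m mQ lQ
        by (simp add: y'_def add.commute)
      then have "int k' < psum y' (Q n)" using k' k_less by simp
      moreover have "(shift ^^ k) (spell y) = (shift ^^ k') (spell y')"
        using k' ps[of m] m lQ by (simp add: shift_funpow y'_def spell_translate fun_eq_iff ac_simps)
      ultimately show ?thesis using D_atom[OF y'] s' by metis
    qed
    then show ?thesis
      using y0 unfolding p(2) atoms_def
      by (intro bexI[of _ "atom shift (tower n) (s', k')"])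
        (auto simp: atom_def[of shift "tower (Suc n)"] elim!: tower_baseE)
  qed
  show "topology_generated_by (\<Union>n. atoms shift (tower n)) = top_of_set X"
    unfolding topology_eq
  proof (intro allI iffI)
    fix U assume "openin (topology_generated_by (\<Union>n. atoms shift (tower n))) U"
    then have "generate_topology_on (\<Union>n. atoms shift (tower n)) U"
      by (rule openin_topology_generated_by)
    then show "openin (top_of_set X) U"
      by induction (auto intro: openin_atom[OF ckr_tower])
  next
    fix U assume U: "openin (top_of_set X) U"
    have "\<exists>V. openin (topology_generated_by (\<Union>n. atoms shift (tower n))) V \<and> x \<in> V \<and> V \<subseteq> U"
      if x: "x \<in> U" for x
    proof -
      have xX: "x \<in> X" using U x openin_imp_subset by blast
      obtain L where L: "\<And>x'. x' \<in> X \<Longrightarrow> (\<And>i. \<bar>i\<bar> \<le> L \<Longrightarrow> x' i = x i) \<Longrightarrow> x' \<in> U"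
        using U x unfolding openin_cylinders by meson
      define n where "n = nat L"
      obtain y k where y: "y \<in> D n" "int k < psum y (Q n)" "x = (shift ^^ k) (spell y)"
        using D_decomposition[OF xX] .
      define C where "C = atom shift (tower n) (y (Q n - hole n), k)"
      have C: "C \<in> atoms shift (tower n)" "x \<in> C"
        using D_atom[OF y(1,2)] y(3) by (auto simp: C_def atoms_def)
      have "x' \<in> U" if x': "x' \<in> C" for x'
      proof -
        obtain y' where y': "y' \<in> D n" "y' (Q n - hole n) = y (Q n - hole n)"
            "x' = (shift ^^ k) (spell y')"
          by (rule tower_atomE[OF D_atom(1)[OF y(1,2)] x'[unfolded C_def]]) simp
        show ?thesis
        proof (rule L)
          show "x' \<in> X" using y' by (simp add: X_funpow spell_in_X D_Y)
          fix i assume "\<bar>i\<bar> \<le> L"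
          then have i: "\<bar>i\<bar> \<le> int n" unfolding n_def by linarith
          \<comment> \<open>The cut inside the word pays off: for \<open>k\<close> below the height,
            the window of radius \<open>n\<close> around \<open>k\<close> stays between the zeros
            \<open>- hole n\<close> and \<open>2 * Q n - hole n - 1\<close>, where the label
            determines the code.\<close>
          have h: "- hole n \<le> 0" "0 \<le> 2 * Q n - hole n - 1" "int n \<le> hole n" "2 * hole n + 1 \<le> Q n"
            using hole_nonneg[of n] hole_le[of n] hole_ge[of n] by linarith+
          have "psum y (Q n) + (Q n - hole n - 1) \<le> psum y (2 * Q n - hole n - 1)"
            using psum_diff_ge[of "Q n" "2 * Q n - hole n - 1" y] h by linarith
          then have "psum y (- hole n) \<le> i + int k" "i + int k \<le> psum y (2 * Q n - hole n - 1)"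
            using psum_le[OF h(1), of y] i y(2) h by linarith+
          moreover have "y j = y' j" if "- hole n < j" "j \<le> 2 * Q n - hole n - 1" for j
            using D_fill[OF y(1), of j] D_fill[OF y'(1), of j] that y'(2) by simp
          ultimately have "spell y (i + int k) = spell y' (i + int k)"
            by (intro spell_cong[OF _ h(1,2)])
          then show "x' i = x i" using y(3) y'(3) by (simp add: shift_funpow)
        qed
      qed
      moreover have "openin (topology_generated_by (\<Union>n. atoms shift (tower n))) C"
        using C(1) by (intro topology_generated_by_Basis) blast
      ultimately show ?thesis using C(2) by blast
    qed
    then show "openin (topology_generated_by (\<Union>n. atoms shift (tower n))) U"
      by (subst openin_subopen) blast
  qed
qed

end

section \<open>The lower bound\<close>

text \<open>Each spacer is charged to the zero in front of it; \<open>None\<close> marks the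
  positions of ones, so orbit sums can count every spacer once.\<close>

definition gap :: "(int \<Rightarrow> nat) \<Rightarrow> nat option" where
  "gap x = (if x 0 = 0 then Some (LEAST d. x (1 + int d) = 0) else None)"

lemma gap_spell: "gap (spell y) = Some (y 1)"
proof -
  have "(LEAST d. spell y (1 + int d) = 0) = y 1"
  proof (rule Least_equality)
    show "spell y (1 + int (y 1)) = 0" using spell_gap_right[of "y 1" y 0] by simp
    show "y 1 \<le> d" if "spell y (1 + int d) = 0" for d
      using spell_gap_right[of d y 0] that by (cases "d \<le> y 1") auto
  qed
  then show ?thesis by (simp add: gap_def)
qed

lemma sum_gap_block:
  fixes w :: "nat option \<Rightarrow> real"
  assumes "w None = 0" and "0 \<le> m"
  shows "(\<Sum>k<nat (psum y m). w (gap (\<lambda>i. spell y (i + int k)))) = (\<Sum>j\<in>{1..m}. w (Some (y j)))"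
  using assms(2)
proof (induction m rule: int_ge_induct)
  case (step m)
  define f where "f k = w (gap (\<lambda>i. spell y (i + int k)))" for k
  define N where "N = nat (psum y m)"
  have N: "int N = psum y m" using psum_ge[OF step(1), of y] step(1) by (simp add: N_def)
  have "(\<lambda>i. spell y (i + int N)) = spell (\<lambda>j. y (j + m))" by (simp add: N spell_translate fun_eq_iff)
  then have fN: "f N = w (Some (y (m + 1)))" by (simp add: f_def gap_spell add.commute)
  have "(\<Sum>k<N + Suc d. f k) = (\<Sum>k<N. f k) + f N" if "d \<le> y (m + 1)" for d
    using that
  proof (induction d)
    case (Suc d)
    then have "spell y (int (N + Suc d)) = 1"
      by (intro spell_between[of y m]) (simp_all add: N psum_Suc[of y m])
    then have "f (N + Suc d) = 0" using assms(1) by (simp add: f_def gap_def add_ac)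
    with Suc show ?case by simp
  qed simp
  moreover have "nat (psum y (m + 1)) = N + Suc (y (m + 1))"
    using N psum_Suc[of y m] by linarith
  ultimately have "(\<Sum>k<nat (psum y (m + 1)). f k) = (\<Sum>k<N. f k) + f N" by simp
  moreover have "(\<Sum>k<N. f k) = (\<Sum>j\<in>{1..m}. w (Some (y j)))" using step(2) by (simp add: f_def N_def)
  moreover have "{1..m + 1} = insert (m + 1) {1..m}" using step(1) by auto
  ultimately show ?case using fN by (simp add: f_def)
qed simp

context ferenczi_parameters
begin

lemma limit_spacers_subset: "limit_spacers q a \<subseteq> spacers n"
proof -
  obtain N where N: "\<And>m. N \<le> m \<Longrightarrow> spacers_from q a m = limit_spacers q a"
    using eventually_spacers_from[OF bdd] unfolding eventually_sequentially by blast
  have "spacers (max N n) \<subseteq> spacers n" by (rule spacers_antimono) simp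
  with N[of "Suc (max N n)"] show ?thesis by simp
qed

lemma eventually_card_spacers:
  "\<forall>\<^sub>F n in sequentially. card (spacers n) = num_limit_spacers q a"
proof -
  have "\<forall>\<^sub>F n in sequentially. spacers_from q a (Suc n) = limit_spacers q a"
    using eventually_spacers_from[OF bdd] by (subst eventually_sequentially_Suc)
  then show ?thesis by eventually_elim (simp add: num_limit_spacers_def)
qed

lemma finite_limit_spacers: "finite (limit_spacers q a)"
  using finite_subset[OF limit_spacers_subset finite_spacers] .

lemma gap_locally_constant:
  assumes "x \<in> X"
  shows "\<exists>U. openin (top_of_set X) U \<and> x \<in> U \<and> (\<forall>x'\<in>U. gap x' = gap x)"
proof (intro exI conjI)
  have "\<exists>L. \<forall>x'\<in>X. (\<forall>i. \<bar>i\<bar> \<le> L \<longrightarrow> x' i = x i) \<longrightarrow> gap x' = gap x" if x: "x \<in> X" for x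
  proof (cases "x 0 = 0")
    case True
    then obtain y where y: "y \<in> Y" "x = spell y" using X_spell[OF x] by blast
    \<comment> \<open>The spacer after the origin is entry \<open>1\<close>, so the radius is that
      of \<open>spell_determines\<close> with \<open>L = 1\<close>.\<close>
    show ?thesis
    proof (intro exI[of _ "(int K + 1) * (1 + 1)"] ballI impI)
      fix x' assume x': "x' \<in> X" "\<forall>i. \<bar>i\<bar> \<le> (int K + 1) * (1 + 1) \<longrightarrow> x' i = x i"
      have "x' 0 = 0" using x'(2)[rule_format, of 0] True by simp
      then obtain y' where y': "y' \<in> Y" "x' = spell y'" using X_spell[OF x'(1)] by blast
      have "y 1 = y' 1"
        using x'(2) by (intro spell_determines[of y K 1 y' 1]) (auto simp: Y_le[OF y(1)] y(2) y'(2))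
      then show "gap x' = gap x" by (simp add: y(2) y'(2) gap_spell)
    qed
  next
    case False
    then show ?thesis by (intro exI[of _ 0]) (auto simp: gap_def)
  qed
  from this show "openin (top_of_set X) {x' \<in> X. gap x' = gap x}"
    unfolding openin_cylinders by (auto; metis)
qed (use assms in auto)

end

context aperiodic_ferenczi
begin

text \<open>The block sums over the towers of \<open>s\<close> and \<open>s'\<close> differ by \<open>w s - w s'\<close>, so \<open>w\<close> is constant on
  the limit spacers; a block sum then is a positive multiple of this constant.\<close>

lemma block_sums_zero:
  fixes w :: "nat option \<Rightarrow> real"
  assumes w: "\<And>s. s \<notin> limit_spacers q a \<Longrightarrow> w (Some s) = 0"
    and zero: "\<And>s. s \<in> limit_spacers q a \<Longrightarrow> (\<Sum>j\<in>{1..Q n}. w (Some (fill n s j))) = 0"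
    and s: "s \<in> limit_spacers q a"
  shows "w (Some s) = 0"
proof -
  \<comment> \<open>The only hole among the indices \<open>1\<close> to \<open>Q n\<close>;
    elsewhere \<open>fill\<close> does not depend on the label, and \<open>C\<close> is the common
    contribution.\<close>
  define h where "h = Q n - hole n"
  have h: "h \<in> {1..Q n}" using hole_le[of n] hole_nonneg[of n] unfolding h_def by simp
  define C where "C = (\<Sum>j\<in>{1..Q n} - {h}. w (Some (toep (j + hole n))))"
  have nd: "\<not> Q n dvd j + hole n" if "j \<in> {1..Q n} - {h}" for j
  proof
    assume "Q n dvd j + hole n"
    then have "Q n dvd j - h" unfolding h_def by (simp add: algebra_simps)
    moreover have "\<bar>j - h\<bar> < Q n" "j - h \<noteq> 0" using that h by auto
    ultimately show False using zdvd_imp_le[of "Q n" "\<bar>j - h\<bar>"] by simp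
  qed
  have fill_h: "fill n t h = t" for t by (simp add: fill_def h_def)
  have sum: "w (Some t) = - C" if "t \<in> limit_spacers q a" for t
  proof -
    have "(\<Sum>j\<in>{1..Q n} - {h}. w (Some (fill n t j))) = C"
      unfolding C_def using nd by (intro sum.cong) (auto simp: fill_def)
    then show ?thesis using zero[OF that] h by (simp add: sum.remove[of _ h] fill_h)
  qed
  \<comment> \<open>Each limit spacer in the block contributes \<open>- C\<close>, everything else
    \<open>0\<close>; index \<open>h\<close> makes the count positive, so
    \<open>C = 0\<close>.\<close>
  have "(\<Sum>j\<in>{1..Q n}. w (Some (fill n s j)))
      = (\<Sum>j\<in>{j \<in> {1..Q n}. fill n s j \<in> limit_spacers q a}. - C)"
    by (subst sum.inter_filter) (auto intro!: sum.cong simp: w sum)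
  then have eq0: "real (card {j \<in> {1..Q n}. fill n s j \<in> limit_spacers q a}) * C = 0"
    using zero[OF s] by simp
  have "h \<in> {j \<in> {1..Q n}. fill n s j \<in> limit_spacers q a}" using h s by (simp add: fill_h)
  moreover have "finite {j \<in> {1..Q n}. fill n s j \<in> limit_spacers q a}"
    by (rule finite_subset[of _ "{1..Q n}"]) auto
  ultimately have "card {j \<in> {1..Q n}. fill n s j \<in> limit_spacers q a} \<noteq> 0"
    unfolding card_eq_0_iff by blast
  with eq0 show ?thesis using sum[OF s] by simp
qed

text \<open>The bases of \<open>tower n\<close> shrink to \<open>spell star\<close>, so for large
  \<open>n\<close> the function \<open>g\<close> is constant on them. A full passage leads from base
  to base and therefore has sum zero, for every limit spacer as label.\<close>

lemma gap_not_coboundary: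
  fixes w :: "nat option \<Rightarrow> real"
  assumes w: "w None = 0" "\<And>s. s \<notin> limit_spacers q a \<Longrightarrow> w (Some s) = 0"
    and g: "\<And>x. x \<in> X \<Longrightarrow> g (shift x) = g x + w (gap x)"
    and U: "openin (top_of_set X) U" "spell star \<in> U" "\<And>x. x \<in> U \<Longrightarrow> g x = g (spell star)"
    and s: "s \<in> limit_spacers q a"
  shows "w (Some s) = 0"
proof -
  obtain L where L: "\<And>x. x \<in> X \<Longrightarrow> (\<And>i. \<bar>i\<bar> \<le> L \<Longrightarrow> x i = spell star i) \<Longrightarrow> x \<in> U"
    using U(1,2) unfolding openin_cylinders by meson
  define n where "n = nat L"
  have gD: "g (spell y) = g (spell star)" if "y \<in> D n" for y
  proof (rule U(3), rule L)
    fix i assume "\<bar>i\<bar> \<le> L"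
    then have "\<bar>i\<bar> \<le> int n" unfolding n_def by linarith
    with that show "spell y i = spell star i" by (intro D_window[OF _ star_D])
  qed (use that D_Y spell_in_X in auto)
  have zero: "(\<Sum>j\<in>{1..Q n}. w (Some (fill n t j))) = 0" if t: "t \<in> limit_spacers q a" for t
  proof -
    obtain y where y: "y \<in> D n" "y (Q n - hole n) = t"
      using D_label_ex[OF subsetD[OF limit_spacers_subset t]] .
    have sum: "g ((shift ^^ m) (spell y)) = g (spell y) + (\<Sum>k<m. w (gap ((shift ^^ k) (spell y))))" for m
    proof (induction m)
      case (Suc m)
      have "(shift ^^ m) (spell y) \<in> X" using D_Y[OF y(1)] by (intro X_funpow spell_in_X)
      from g[OF this] Suc show ?case by simp
    qed simp
    have "0 \<le> psum y (Q n)" using psum_ge[of "Q n" y] Q_pos[of n] by linarith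
    then have "(shift ^^ nat (psum y (Q n))) (spell y) = spell (\<lambda>j. y (j + Q n))"
      by (simp add: shift_funpow spell_translate fun_eq_iff)
    moreover have "(\<lambda>j. y (j + Q n)) \<in> D n" using D_translate[OF y(1)] by simp
    ultimately have "(\<Sum>k<nat (psum y (Q n)). w (gap ((shift ^^ k) (spell y)))) = 0"
      using sum[of "nat (psum y (Q n))"] gD[OF y(1)] gD[of "\<lambda>j. y (j + Q n)"] by simp
    then have "(\<Sum>j\<in>{1..Q n}. w (Some (y j))) = 0"
      using sum_gap_block[of w "Q n" y] w(1) less_imp_le[OF Q_pos[of n]] by (simp add: shift_funpow)
    moreover have "y j = fill n t j" if "j \<in> {1..Q n}" for j
      using D_fill[OF y(1), of j] that y(2) hole_nonneg[of n] hole_le[of n] by simp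
    ultimately show ?thesis by simp
  qed
  show ?thesis by (rule block_sums_zero[OF w(2) zero s])
qed

lemma nested_ckr_card_labels:
  assumes P: "nested_ckr X shift P"
  shows "\<forall>\<^sub>F n in sequentially. num_limit_spacers q a \<le> card (labels (P n))"
  using nested_ckr_locally_constant[OF P compact_X gap_locally_constant, simplified]
proof eventually_elim
  fix n
  assume const: "\<forall>C\<in>atoms shift (P n). \<forall>x\<in>C. \<forall>x'\<in>C. gap x = gap x'"
  let ?A = "limit_spacers q a"
  have ckr: "ckr_partition X shift (P n)" using P by (simp add: nested_ckr_def)
  show "num_limit_spacers q a \<le> card (labels (P n))"
  proof (rule ccontr)
    assume "\<not> ?thesis"
    then have less: "card (labels (P n)) < card ?A" by (simp add: num_limit_spacers_def)
    define z where "z b = (SOME z. z \<in> tower_base (P n) b)" for b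
    \<comment> \<open>\<open>M b s\<close> counts the spacer \<open>s\<close> along tower
      \<open>b\<close>; with fewer towers than limit spacers some nonzero \<open>c\<close>
      annihilates all rows.\<close>
    define M :: "nat \<Rightarrow> nat \<Rightarrow> real" where
      "M b s = (\<Sum>k<height (P n) b. of_bool (gap ((shift ^^ k) (z b)) = Some s))" for b s
    have "finite (labels (P n))" using ckr by (simp add: ckr_partition_def)
    then obtain c where c: "\<exists>s\<in>?A. c s \<noteq> 0" "\<And>b. b \<in> labels (P n) \<Longrightarrow> (\<Sum>s\<in>?A. c s * M b s) = 0"
      using linear_dependence[OF _ finite_limit_spacers less] by blast
    define w where "w u = (\<Sum>s\<in>?A. c s * of_bool (u = Some s))" for u
    have wS: "w (Some s) = (if s \<in> ?A then c s else 0)" for s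
      unfolding w_def using finite_limit_spacers by (simp add: of_bool_def if_distrib sum.If_cases cong: if_cong)
    have "(\<Sum>k<height (P n) b. w (gap ((shift ^^ k) x))) = 0"
      if b: "b \<in> labels (P n)" and x: "x \<in> tower_base (P n) b" for b x
    proof -
      have "z b \<in> tower_base (P n) b" unfolding z_def some_in_eq using x by blast
      have "gap ((shift ^^ k) x) = gap ((shift ^^ k) (z b))" if k: "k < height (P n) b" for k
      proof -
        have "atom shift (P n) (b, k) \<in> atoms shift (P n)"
          using b k by (auto simp: atoms_def levels_def)
        moreover have "(shift ^^ k) x \<in> atom shift (P n) (b, k)" "(shift ^^ k) (z b) \<in> atom shift (P n) (b, k)"
          using x \<open>z b \<in> _\<close> by (auto simp: atom_def)
        ultimately show ?thesis using const by blast
      qed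
      then have "(\<Sum>k<height (P n) b. w (gap ((shift ^^ k) x)))
          = (\<Sum>k<height (P n) b. \<Sum>s\<in>?A. c s * of_bool (gap ((shift ^^ k) (z b)) = Some s))"
        by (simp add: w_def)
      also have "\<dots> = (\<Sum>s\<in>?A. c s * M b s)"
        unfolding M_def sum_distrib_left by (rule sum.swap)
      finally show ?thesis using c(2)[OF b] by simp
    qed
    moreover have "shift ` X \<subseteq> X" using X_funpow[of _ 1] by auto
    moreover have "w (gap x) = w (gap x')" if "C \<in> atoms shift (P n)" "x \<in> C" "x' \<in> C" for C x x'
      using const that by metis
    ultimately obtain g where g: "\<And>x. x \<in> X \<Longrightarrow> g (shift x) = g x + w (gap x)"
        "\<And>C x x'. C \<in> atoms shift (P n) \<Longrightarrow> x \<in> C \<Longrightarrow> x' \<in> C \<Longrightarrow> g x = g x'"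
      using ckr_coboundary[OF ckr inj_shift, of "\<lambda>x. w (gap x)"] by blast
    obtain C where C: "C \<in> atoms shift (P n)" "spell star \<in> C"
      using ckr_atom_ex[OF ckr spell_in_X[OF D_Y[OF star_D]]] .
    \<comment> \<open>The atom around \<open>spell star\<close> is the open set on which
      \<open>g\<close> is constant.\<close>
    have "w (Some s) = 0" if "s \<in> ?A" for s
      by (rule gap_not_coboundary[OF _ _ g(1) openin_atom[OF ckr C(1)] C(2) g(2)[OF C(1) _ C(2)] that])
        (simp_all add: wS, simp add: w_def)
    with c(1) show False by (auto simp: wS)
  qed
qed

end

theorem corollary4p9:
  fixes q :: "nat \<Rightarrow> nat" and a :: "nat \<Rightarrow> nat \<Rightarrow> nat"
  assumes "standard q"
    and "bounded_spacers q a"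
    and "aperiodic_subshift (ferenczi q a)"
  shows "topological_rank (ferenczi q a) shift = enat (num_limit_spacers q a)"
proof -
  interpret aperiodic_ferenczi q a by unfold_locales fact+
  show ?thesis
  proof (rule antisym)
    have "topological_rank X shift \<le> liminf (\<lambda>n. enat (card (labels (tower n))))"
      unfolding topological_rank_def by (rule INF_lower) (simp add: nested_tower)
    also have "\<dots> = enat (num_limit_spacers q a)"
      using eventually_mono[OF eventually_card_spacers]
      by (intro lim_imp_Liminf tendsto_eventually) auto
    finally show "topological_rank X shift \<le> enat (num_limit_spacers q a)" .
    show "enat (num_limit_spacers q a) \<le> topological_rank X shift"
      unfolding topological_rank_def
    proof (rule INF_greatest)
      fix P assume "P \<in> {P. nested_ckr X shift P}"
      then have "\<forall>\<^sub>F n in sequentially. num_limit_spacers q a \<le> card (labels (P n))"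
        by (simp add: nested_ckr_card_labels)
      then show "enat (num_limit_spacers q a) \<le> liminf (\<lambda>n. enat (card (labels (P n))))"
        by (intro Liminf_bounded) (auto elim: eventually_mono)
    qed
  qed
qed

end
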